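(* Let $\mathcal{B}$ be a small category, let $S_\bullet\in \operatorname{Fun}(\mathcal{B},\mathbf{Alg}_{\mathbb{K}})$ be a diagram of commutative algebras and let $k\ge 2$ ($k\in\mathbb{N}\cup\{+\infty\}$). Then the isomorphism classes of deformations of $S_\bullet$ are the same as the isomorphism classes of deformations of $\epsilon^*S_\bullet\in \operatorname{Fun}(N(\mathcal{B})_{\le k},\mathbf{Alg}_{\mathbb{K}})$; that is, for every $A\in\mathbf{Art}_{\mathbb K}$, composition with $\epsilon$, $(\phi\colon S_{\bullet A}\to S_\bullet)\mapsto(\epsilon^*\phi\colon \epsilon^*S_{\bullet A}\to\epsilon^*S_\bullet)$, induces a bijection between isomorphism classes of deformations over $A$ of $S_\bullet$ and of $\epsilon^*S_\bullet$.
   Context: $\mathbb{K}$ is a fixed field of characteristic $0$. $\mathbf{Alg}_{\mathbb{K}}$ is the category of unitary commutative $\mathbb{K}$-algebras; $\mathbf{Art}_{\mathbb{K}}$ is the full subcategory of local Artin algebras with residue field $\mathbb{K}$; $\mathbf{Alg}_A$ is the category of unitary commutative $A$-algebras. $\operatorname{Fun}(\mathcal{D},\mathbf{M})$ is the category of functors (diagrams) $\mathcal{D}\to\mathbf{M}$. **Deformations.** A deformation over $A\in\mathbf{Art}_{\mathbb{K}}$ of a diagram $S_\bullet\colon\mathcal{D}\to\mathbf{Alg}_{\mathbb{K}}$ ($\mathcal D$ a small category) is a diagram $S_{\bullet A}\colon\mathcal{D}\to\mathbf{Alg}_A$ of flat $A$-algebras together with a morphism of diagrams of algebras $\phi\colon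 S_{\bullet A}\to S_\bullet$ inducing an isomorphism $S_{\bullet A}\otimes_A\mathbb{K}\simeq S_\bullet$. Two deformations $\phi\colon S_{\bullet A}\to S_\bullet$, $\psi\colon S'_{\bullet A}\to S_\bullet$ are isomorphic if there is an isomorphism of diagrams of $A$-algebras $\eta\colon S_{\bullet A}\to S'_{\bullet A}$ with $\phi=\psi\eta$. **Simplex category.** For a small category $\mathcal{B}$, the objects of $N(\mathcal{B})$ are the strings $x=[x_0\xrightarrow{\alpha_1}x_1\cdots x_{n-1}\xrightarrow{\alpha_n}x_n]$ of $n$ composable morphisms, $n\ge0$ (the set of such strings is $N(\mathcal{B})_n$). A morphism from $x\in N(\mathcal{B})_n$ to $y=[y_0\xrightarrow{\beta_1}\cdots\xrightarrow{\beta_m}y_m]\in N(\mathcal{B})_m$ is a non-decreasing map $f\colon[n]\to[m]$, where $[n]=\{0,\dots,n\}$, such that $y_{f(i)}=x_i$ for all $i\in[n]$ and, for $1\le i\le n$, $\alpha_i=\beta_{f(i)}\circ\cdots\circ\beta_{f(i-1)+1}$ (which means $\alpha_i=\mathrm{Id}$ if $f(i-1)=f(i)$). $N(\mathcal{B})_{\le k}$ is the full subcategory on objects in $\bigcup_{i\le k}N(\mathcal{B})_i$. The functor $\epsilon\colon N(\mathcal{B})\to\mathcal{B}$ is $\epsilon([x_0\to\cdots\to x_n])=x_n$ on objects and, for a morphism $f\colon x\to y$ from $x=[x_0\xrightarrow{\alpha_1}\cdots\xrightarrow{\alpha_n}x_n]$ to $y=[y_0\xrightarrow{\beta_1}\cdots\xrightarrow{\beta_m}y_m]$,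 given by a non-decreasing map $f\colon[n]\to[m]$, $\epsilon(f)=\beta_m\circ\cdots\circ\beta_{f(n)+1}\colon x_n=y_{f(n)}\to y_m$. For a diagram $F$ on $\mathcal{B}$, $\epsilon^*F=F\circ\epsilon_{|N(\mathcal{B})_{\le k}}$. *)

theory Defs
  imports
    "HOL-Algebra.QuotRing"
    "HOL-Algebra.Module"
    "HOL-Algebra.Generated_Groups"
    "HOL-Algebra.Free_Abelian_Groups"
    "HOL-Library.Extended_Nat"
begin

section \<open>Small categories\<close>

record ('o, 'm) cat =
  Obj :: "'o set"
  Arr :: "'m set"
  Dom :: "'m \<Rightarrow> 'o"
  Cod :: "'m \<Rightarrow> 'o"
  Ide :: "'o \<Rightarrow> 'm"
  Cmp :: "'m \<Rightarrow> 'm \<Rightarrow> 'm"  \<comment> \<open>\<open>Cmp B g f\<close> is \<open>g\<close> after \<open>f\<close>\<close>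

locale category =
  fixes B :: "('o, 'm) cat"
  assumes dom_closed: "f \<in> Arr B \<Longrightarrow> Dom B f \<in> Obj B"
    and cod_closed: "f \<in> Arr B \<Longrightarrow> Cod B f \<in> Obj B"
    and ide_closed: "x \<in> Obj B \<Longrightarrow> Ide B x \<in> Arr B"
    and dom_ide: "x \<in> Obj B \<Longrightarrow> Dom B (Ide B x) = x"
    and cod_ide: "x \<in> Obj B \<Longrightarrow> Cod B (Ide B x) = x"
    and cmp_closed: "\<lbrakk>f \<in> Arr B; g \<in> Arr B; Dom B g = Cod B f\<rbrakk> \<Longrightarrow> Cmp B g f \<in> Arr B"
    and dom_cmp: "\<lbrakk>f \<in> Arr B; g \<in> Arr B; Dom B g = Cod B f\<rbrakk> \<Longrightarrow> Dom B (Cmp B g f) = Dom B f"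
    and cod_cmp: "\<lbrakk>f \<in> Arr B; g \<in> Arr B; Dom B g = Cod B f\<rbrakk> \<Longrightarrow> Cod B (Cmp B g f) = Cod B g"
    and cmp_ide_right: "f \<in> Arr B \<Longrightarrow> Cmp B f (Ide B (Dom B f)) = f"
    and cmp_ide_left: "f \<in> Arr B \<Longrightarrow> Cmp B (Ide B (Cod B f)) f = f"
    and cmp_assoc: "\<lbrakk>f \<in> Arr B; g \<in> Arr B; h \<in> Arr B; Dom B g = Cod B f; Dom B h = Cod B g\<rbrakk>
      \<Longrightarrow> Cmp B h (Cmp B g f) = Cmp B (Cmp B h g) f"


section \<open>The simplex category\<close>

text \<open>A string \<open>x\<^sub>0 \<rightarrow> \<dots> \<rightarrow> x\<^sub>n\<close> is the pair of the list of its \<open>n + 1\<close> objects and the list of its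
  \<open>n\<close> arrows. Lists are indexed from \<open>0\<close>, so the arrow \<open>\<alpha>\<^sub>i\<close> of the literature is \<open>as ! (i - 1)\<close>.\<close>

type_synonym ('o, 'm) strng = "'o list \<times> 'm list"

definition strings :: "('o, 'm) cat \<Rightarrow> ('o, 'm) strng set" where
  "strings B = {(xs, as). length xs = Suc (length as) \<and> set xs \<subseteq> Obj B \<and>
     (\<forall>i < length as. as ! i \<in> Arr B \<and> Dom B (as ! i) = xs ! i \<and> Cod B (as ! i) = xs ! Suc i)}"

definition dim :: "('o, 'm) strng \<Rightarrow> nat" where
  "dim x = length (snd x)"

text \<open>\<open>segment B y i j\<close> is \<open>\<beta>\<^sub>j \<circ> \<dots> \<circ> \<beta>\<^bsub>i+1\<^esub> : y\<^sub>i \<rightarrow> y\<^sub>j\<close>, the identity of \<open>y\<^sub>i\<close> if \<open>i = j\<close>.\<close>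

definition segment :: "('o, 'm) cat \<Rightarrow> ('o, 'm) strng \<Rightarrow> nat \<Rightarrow> nat \<Rightarrow> 'm" where
  "segment B y i j = fold (\<lambda>l g. Cmp B (snd y ! l) g) [i..<j] (Ide B (fst y ! i))"

text \<open>A morphism \<open>x \<rightarrow> y\<close> is a triple \<open>(x, f, y)\<close>; the map \<open>f\<close> is kept extensional outside
  \<open>{..n}\<close>, so that equality of triples is equality of morphisms.\<close>

type_synonym ('o, 'm) strng_arr = "('o, 'm) strng \<times> (nat \<Rightarrow> nat) \<times> ('o, 'm) strng"

definition simplex_hom ::
  "('o, 'm) cat \<Rightarrow> ('o, 'm) strng \<Rightarrow> ('o, 'm) strng \<Rightarrow> (nat \<Rightarrow> nat) set" where
  "simplex_hom B x y = {f \<in> {..dim x} \<rightarrow>\<^sub>E {..dim y}. mono_on {..dim x} f \<and>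
     (\<forall>i \<le> dim x. fst y ! f i = fst x ! i) \<and>
     (\<forall>i < dim x. snd x ! i = segment B y (f i) (f (Suc i)))}"

text \<open>The category \<open>N(B)\<^bsub>\<le>k\<^esub>\<close>; for \<open>k = \<infinity>\<close> it is the whole of \<open>N(B)\<close>.\<close>

definition simplex_cat :: "('o, 'm) cat \<Rightarrow> enat \<Rightarrow> (('o, 'm) strng, ('o, 'm) strng_arr) cat" where
  "simplex_cat B k =
    \<lparr> Obj = {x \<in> strings B. enat (dim x) \<le> k},
      Arr = {(x, f, y). x \<in> strings B \<and> enat (dim x) \<le> k \<and> y \<in> strings B \<and> enat (dim y) \<le> k \<and>
               f \<in> simplex_hom B x y},
      Dom = (\<lambda>(x, f, y). x),
      Cod = (\<lambda>(x, f, y). y),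
      Ide = (\<lambda>x. (x, \<lambda>i\<in>{..dim x}. i, x)),
      Cmp = (\<lambda>(y, g, z) (x, f, y'). (x, compose {..dim x} g f, z)) \<rparr>"

definition eps_obj :: "('o, 'm) strng \<Rightarrow> 'o" where
  "eps_obj x = fst x ! dim x"

definition eps_arr :: "('o, 'm) cat \<Rightarrow> ('o, 'm) strng_arr \<Rightarrow> 'm" where
  "eps_arr B = (\<lambda>(x, f, y). segment B y (f (dim x)) (dim y))"


section \<open>Modules, algebras and tensor products\<close>

definition lin_hom :: "('a, 'z) ring_scheme \<Rightarrow> ('a, 'b) module \<Rightarrow> ('a, 'c) module \<Rightarrow> ('b \<Rightarrow> 'c) set" where
  "lin_hom A M N = {f \<in> carrier M \<rightarrow> carrier N.
     (\<forall>x \<in> carrier M. \<forall>y \<in> carrier M. f (x \<oplus>\<^bsub>M\<^esub> y) = f x \<oplus>\<^bsub>N\<^esub> f y) \<and>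
     (\<forall>a \<in> carrier A. \<forall>x \<in> carrier M. f (a \<odot>\<^bsub>M\<^esub> x) = a \<odot>\<^bsub>N\<^esub> f x)}"

definition alg_hom :: "('a, 'z) ring_scheme \<Rightarrow> ('a, 'b) module \<Rightarrow> ('a, 'c) module \<Rightarrow> ('b \<Rightarrow> 'c) set" where
  "alg_hom A M N = {h \<in> ring_hom M N.
     \<forall>a \<in> carrier A. \<forall>x \<in> carrier M. h (a \<odot>\<^bsub>M\<^esub> x) = a \<odot>\<^bsub>N\<^esub> h x}"

definition alg_iso :: "('a, 'z) ring_scheme \<Rightarrow> ('a, 'b) module \<Rightarrow> ('a, 'c) module \<Rightarrow> ('b \<Rightarrow> 'c) set" where
  "alg_iso A M N = {h \<in> alg_hom A M N. bij_betw h (carrier M) (carrier N)}"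

definition with_smult :: "('b, 'z) ring_scheme \<Rightarrow> ('a \<Rightarrow> 'b \<Rightarrow> 'b) \<Rightarrow> ('a, 'b) module" where
  "with_smult M s = \<lparr> carrier = carrier M, monoid.mult = monoid.mult M, one = one M,
     ring.zero = ring.zero M, add = add M, smult = s \<rparr>"

text \<open>The tensor product over \<open>A\<close> is the free abelian group on \<open>M \<times> N\<close> modulo the subgroup
  generated by the bilinearity relations; its elements are cosets. Maps on cosets are
  given as unions over all representatives; for bilinear data these unions are single cosets.
  The multiplicative part (\<open>mult\<close>, \<open>one\<close>) of the record is meaningful only if \<open>M\<close> and \<open>N\<close> are
  algebras.\<close>

definition tensor_free :: "('a, 'b) module \<Rightarrow> ('a, 'c) module \<Rightarrow> (('b \<times> 'c) \<Rightarrow>\<^sub>0 int) monoid" where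
  "tensor_free M N = free_Abelian_group (carrier M \<times> carrier N)"

definition tensor_relators ::
  "('a, 'z) ring_scheme \<Rightarrow> ('a, 'b) module \<Rightarrow> ('a, 'c) module \<Rightarrow> (('b \<times> 'c) \<Rightarrow>\<^sub>0 int) set" where
  "tensor_relators A M N =
     {frag_of (x \<oplus>\<^bsub>M\<^esub> x', y) - frag_of (x, y) - frag_of (x', y) | x x' y.
        x \<in> carrier M \<and> x' \<in> carrier M \<and> y \<in> carrier N} \<union>
     {frag_of (x, y \<oplus>\<^bsub>N\<^esub> y') - frag_of (x, y) - frag_of (x, y') | x y y'.
        x \<in> carrier M \<and> y \<in> carrier N \<and> y' \<in> carrier N} \<union>
     {frag_of (a \<odot>\<^bsub>M\<^esub> x, y) - frag_of (x, a \<odot>\<^bsub>N\<^esub> y) | a x y.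
        a \<in> carrier A \<and> x \<in> carrier M \<and> y \<in> carrier N}"

definition tensor_coset ::
  "('a, 'z) ring_scheme \<Rightarrow> ('a, 'b) module \<Rightarrow> ('a, 'c) module \<Rightarrow>
   (('b \<times> 'c) \<Rightarrow>\<^sub>0 int) \<Rightarrow> (('b \<times> 'c) \<Rightarrow>\<^sub>0 int) set" where
  "tensor_coset A M N p =
     generate (tensor_free M N) (tensor_relators A M N) #>\<^bsub>tensor_free M N\<^esub> p"

definition pure_tensor ::
  "('a, 'z) ring_scheme \<Rightarrow> ('a, 'b) module \<Rightarrow> ('a, 'c) module \<Rightarrow>
   'b \<Rightarrow> 'c \<Rightarrow> (('b \<times> 'c) \<Rightarrow>\<^sub>0 int) set" where
  "pure_tensor A M N x y = tensor_coset A M N (frag_of (x, y))"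

definition tensor_map ::
  "('a, 'z) ring_scheme \<Rightarrow> ('a, 'd) module \<Rightarrow> ('a, 'e) module \<Rightarrow> ('b \<Rightarrow> 'd) \<Rightarrow> ('c \<Rightarrow> 'e) \<Rightarrow>
   (('b \<times> 'c) \<Rightarrow>\<^sub>0 int) set \<Rightarrow> (('d \<times> 'e) \<Rightarrow>\<^sub>0 int) set" where
  "tensor_map A M' N' f g U =
     (\<Union>p \<in> U. tensor_coset A M' N' (frag_extend (\<lambda>(x, y). frag_of (f x, g y)) p))"

definition tensor_mult ::
  "('a, 'z) ring_scheme \<Rightarrow> ('a, 'b) module \<Rightarrow> ('a, 'c) module \<Rightarrow>
   (('b \<times> 'c) \<Rightarrow>\<^sub>0 int) set \<Rightarrow> (('b \<times> 'c) \<Rightarrow>\<^sub>0 int) set \<Rightarrow> (('b \<times> 'c) \<Rightarrow>\<^sub>0 int) set" where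
  "tensor_mult A M N U V = (\<Union>p \<in> U. \<Union>q \<in> V. tensor_coset A M N
     (frag_extend (\<lambda>(x, y). frag_extend (\<lambda>(x', y'). frag_of (x \<otimes>\<^bsub>M\<^esub> x', y \<otimes>\<^bsub>N\<^esub> y')) q) p))"

definition tensor ::
  "('a, 'z) ring_scheme \<Rightarrow> ('a, 'b) module \<Rightarrow> ('a, 'c) module \<Rightarrow>
   ('a, (('b \<times> 'c) \<Rightarrow>\<^sub>0 int) set) module" where
  "tensor A M N =
    \<lparr> carrier = tensor_coset A M N ` carrier (tensor_free M N),
      monoid.mult = tensor_mult A M N,
      one = pure_tensor A M N \<one>\<^bsub>M\<^esub> \<one>\<^bsub>N\<^esub>,
      ring.zero = tensor_coset A M N 0,
      add = (\<lambda>U V. U <#>\<^bsub>tensor_free M N\<^esub> V),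
      smult = (\<lambda>a. tensor_map A M N (\<lambda>x. a \<odot>\<^bsub>M\<^esub> x) (\<lambda>y. y)) \<rparr>"

text \<open>Flatness: tensoring with \<open>M\<close> preserves injectivity of \<open>A\<close>-linear maps. HOL cannot quantify
  over all types inside a definition, so the test modules have their elements in the type of the
  elements of \<open>A\<close>. They include all the inclusions \<open>I \<subseteq> A\<close> of ideals, and preserving the injectivity
  of these is already equivalent to flatness, so nothing is lost.\<close>

definition flat :: "('a, 'z) ring_scheme \<Rightarrow> ('a, 'b) module \<Rightarrow> bool" where
  "flat A M \<longleftrightarrow> Module.module A M \<and>
     (\<forall>(P :: ('a, 'a) module) (Q :: ('a, 'a) module) f.
        Module.module A P \<and> Module.module A Q \<and> f \<in> lin_hom A P Q \<and> inj_on f (carrier P) \<longrightarrow>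
        inj_on (tensor_map A Q M f (\<lambda>x. x)) (carrier (tensor A P M)))"


section \<open>Local Artin algebras with residue field \<open>K\<close>\<close>

definition artinian :: "('a, 'z) ring_scheme \<Rightarrow> bool" where
  "artinian A \<longleftrightarrow> (\<forall>I :: nat \<Rightarrow> 'a set.
     (\<forall>n. ideal (I n) A \<and> I (Suc n) \<subseteq> I n) \<longrightarrow> (\<exists>n. \<forall>m \<ge> n. I m = I n))"

definition max_ideal :: "('a, 'z) ring_scheme \<Rightarrow> 'a set" where
  "max_ideal A = (THE I. maximalideal I A)"

definition Art :: "'k ring \<Rightarrow> ('k, 'a) module set" where
  "Art K = {A. algebra K A \<and> artinian A \<and> (\<exists>!I. maximalideal I A) \<and>
     (\<lambda>c. max_ideal A +>\<^bsub>A\<^esub> (c \<odot>\<^bsub>A\<^esub> \<one>\<^bsub>A\<^esub>)) \<in> ring_iso K (A Quot max_ideal A)}"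

text \<open>The augmentation \<open>A \<rightarrow> A/\<mm>\<^sub>A \<cong> K\<close>, through which \<open>K\<close>-algebras are \<open>A\<close>-algebras.\<close>

definition augment :: "'k ring \<Rightarrow> ('k, 'a) module \<Rightarrow> 'a \<Rightarrow> 'k" where
  "augment K A a = (THE c. c \<in> carrier K \<and>
     max_ideal A +>\<^bsub>A\<^esub> (c \<odot>\<^bsub>A\<^esub> \<one>\<^bsub>A\<^esub>) = max_ideal A +>\<^bsub>A\<^esub> a)"

definition via_augment :: "'k ring \<Rightarrow> ('k, 'a) module \<Rightarrow> ('k, 's) module \<Rightarrow> ('a, 's) module" where
  "via_augment K A S = with_smult S (\<lambda>a s. augment K A a \<odot>\<^bsub>S\<^esub> s)"

definition residue_alg :: "'k ring \<Rightarrow> ('k, 'a) module \<Rightarrow> ('a, 'k) module" where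
  "residue_alg K A = via_augment K A (with_smult K (monoid.mult K))"

text \<open>\<open>M \<otimes>\<^sub>A K\<close> as a \<open>K\<close>-algebra.\<close>

definition base_change ::
  "'k ring \<Rightarrow> ('k, 'a) module \<Rightarrow> ('a, 'c) module \<Rightarrow> ('k, (('c \<times> 'k) \<Rightarrow>\<^sub>0 int) set) module" where
  "base_change K A M = with_smult (tensor A M (residue_alg K A))
     (\<lambda>c. tensor_map A M (residue_alg K A) (\<lambda>x. x) (\<lambda>d. c \<otimes>\<^bsub>K\<^esub> d))"


section \<open>Diagrams of algebras and their deformations\<close>

record ('o, 'm, 'a, 'e) diagram =
  dobj :: "'o \<Rightarrow> ('a, 'e) module"
  darr :: "'m \<Rightarrow> 'e \<Rightarrow> 'e"

definition alg_diagram ::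
  "('o, 'm) cat \<Rightarrow> ('a, 'z) ring_scheme \<Rightarrow> ('o, 'm, 'a, 'e) diagram \<Rightarrow> bool" where
  "alg_diagram D A F \<longleftrightarrow>
     (\<forall>x \<in> Obj D. algebra A (dobj F x)) \<and>
     (\<forall>f \<in> Arr D. darr F f \<in> alg_hom A (dobj F (Dom D f)) (dobj F (Cod D f))) \<and>
     (\<forall>x \<in> Obj D. \<forall>s \<in> carrier (dobj F x). darr F (Ide D x) s = s) \<and>
     (\<forall>f \<in> Arr D. \<forall>g \<in> Arr D. Dom D g = Cod D f \<longrightarrow>
        (\<forall>s \<in> carrier (dobj F (Dom D f)). darr F (Cmp D g f) s = darr F g (darr F f s)))"

definition diagram_hom ::
  "('o, 'm) cat \<Rightarrow> ('a, 'z) ring_scheme \<Rightarrow> ('o, 'm, 'a, 'b) diagram \<Rightarrow> ('o, 'm, 'a, 'c) diagram \<Rightarrow>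
   ('o \<Rightarrow> 'b \<Rightarrow> 'c) set" where
  "diagram_hom D A F G = {\<eta>.
     (\<forall>x \<in> Obj D. \<eta> x \<in> alg_hom A (dobj F x) (dobj G x)) \<and>
     (\<forall>f \<in> Arr D. \<forall>s \<in> carrier (dobj F (Dom D f)).
        \<eta> (Cod D f) (darr F f s) = darr G f (\<eta> (Dom D f) s))}"

definition diagram_iso ::
  "('o, 'm) cat \<Rightarrow> ('a, 'z) ring_scheme \<Rightarrow> ('o, 'm, 'a, 'b) diagram \<Rightarrow> ('o, 'm, 'a, 'c) diagram \<Rightarrow>
   ('o \<Rightarrow> 'b \<Rightarrow> 'c) set" where
  "diagram_iso D A F G = {\<eta> \<in> diagram_hom D A F G.
     \<forall>x \<in> Obj D. \<eta> x \<in> alg_iso A (dobj F x) (dobj G x)}"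

definition diagram_via_augment ::
  "'k ring \<Rightarrow> ('k, 'a) module \<Rightarrow> ('o, 'm, 'k, 's) diagram \<Rightarrow> ('o, 'm, 'a, 's) diagram" where
  "diagram_via_augment K A S = \<lparr> dobj = (\<lambda>x. via_augment K A (dobj S x)), darr = darr S \<rparr>"

text \<open>A deformation of \<open>S\<close> over \<open>A\<close> is a pair \<open>(F, \<phi>)\<close>. The last condition says that the morphism
  \<open>F \<otimes>\<^sub>A K \<rightarrow> S\<close>, \<open>s \<otimes> c \<mapsto> c \<phi>(s)\<close>, induced by \<open>\<phi>\<close> is an isomorphism at every object; its
  naturality follows from that of \<open>\<phi>\<close>.

  The underlying sets of the deformed algebras live in the type \<open>'c\<close>, which is arbitrary. Values of
  \<open>F\<close> and \<open>\<phi>\<close> outside the category and the carriers are irrelevant and are identified by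
  \<open>defo_iso\<close> below.\<close>

type_synonym ('o, 'm, 'a, 'c, 's) defo = "('o, 'm, 'a, 'c) diagram \<times> ('o \<Rightarrow> 'c \<Rightarrow> 's)"

definition deformations ::
  "('o, 'm) cat \<Rightarrow> 'k ring \<Rightarrow> ('k, 'a) module \<Rightarrow> ('o, 'm, 'k, 's) diagram \<Rightarrow>
   ('o, 'm, 'a, 'c, 's) defo set" where
  "deformations D K A S = {(F, \<phi>).
     alg_diagram D A F \<and>
     (\<forall>x \<in> Obj D. flat A (dobj F x)) \<and>
     \<phi> \<in> diagram_hom D A F (diagram_via_augment K A S) \<and>
     (\<forall>x \<in> Obj D. \<exists>h \<in> alg_iso K (base_change K A (dobj F x)) (dobj S x).
        \<forall>s \<in> carrier (dobj F x). \<forall>c \<in> carrier K.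
          h (pure_tensor A (dobj F x) (residue_alg K A) s c) = c \<odot>\<^bsub>dobj S x\<^esub> \<phi> x s)}"

definition defo_iso ::
  "('o, 'm) cat \<Rightarrow> 'k ring \<Rightarrow> ('k, 'a) module \<Rightarrow> ('o, 'm, 'k, 's) diagram \<Rightarrow>
   (('o, 'm, 'a, 'c, 's) defo \<times> ('o, 'm, 'a, 'c, 's) defo) set" where
  "defo_iso D K A S = {((F, \<phi>), (F', \<psi>)).
     (F, \<phi>) \<in> deformations D K A S \<and> (F', \<psi>) \<in> deformations D K A S \<and>
     (\<exists>\<eta> \<in> diagram_iso D A F F'. \<forall>x \<in> Obj D. \<forall>s \<in> carrier (dobj F x). \<phi> x s = \<psi> x (\<eta> x s))}"

definition defo_classes ::
  "('o, 'm) cat \<Rightarrow> 'k ring \<Rightarrow> ('k, 'a) module \<Rightarrow> ('o, 'm, 'k, 's) diagram \<Rightarrow>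
   ('o, 'm, 'a, 'c, 's) defo set set" where
  "defo_classes D K A S = deformations D K A S // defo_iso D K A S"


section \<open>Pullback along \<open>\<epsilon>\<close>\<close>

definition eps_diagram ::
  "('o, 'm) cat \<Rightarrow> ('o, 'm, 'a, 'e) diagram \<Rightarrow> (('o, 'm) strng, ('o, 'm) strng_arr, 'a, 'e) diagram" where
  "eps_diagram B F = \<lparr> dobj = (\<lambda>x. dobj F (eps_obj x)), darr = (\<lambda>f. darr F (eps_arr B f)) \<rparr>"

definition eps_defo ::
  "('o, 'm) cat \<Rightarrow> ('o, 'm, 'a, 'c, 's) defo \<Rightarrow>
   (('o, 'm) strng, ('o, 'm) strng_arr, 'a, 'c, 's) defo" where
  "eps_defo B = (\<lambda>(F, \<phi>). (eps_diagram B F, \<lambda>x. \<phi> (eps_obj x)))"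

end

theory Submission
  imports Defs "HOL-Algebra.Ring_Divisibility"
begin

text \<open>
  Composition with \<open>\<epsilon>\<close> loses nothing because a deformation of \<open>\<epsilon>\<^sup>*S\<close> automatically inverts every
  arrow of \<open>N(B)\<close> that \<open>\<epsilon>\<close> maps to an identity, and such a diagram is determined, up to isomorphism, by a
  diagram on \<open>B\<close>.

  The reason is algebraic. An arrow over an identity is sent to a homomorphism \<open>f : M \<rightarrow> N\<close> of flat
  \<open>A\<close>-algebras that becomes an isomorphism modulo the maximal ideal \<open>\<mm>\<close>, and then \<open>f\<close> is an isomorphism
  (\<open>iso_of_reduction\<close>). Surjectivity is Nakayama's lemma, which holds for arbitrary modules over a
  local Artin ring (\<open>nakayama\<close>). For injectivity, flatness of \<open>N\<close> gives \<open>L \<inter> \<mm> M = \<mm> L\<close> for the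
  kernel \<open>L\<close> (\<open>flat_kernel\<close>), so \<open>L = \<mm> L\<close> and Nakayama's lemma applies once more. The translation
  between the isomorphism \<open>M \<otimes>\<^sub>A K \<cong> S\<close> and the facts that \<open>\<phi> : M \<rightarrow> S\<close> is onto with kernel inside
  \<open>\<mm> M\<close> is made in \<open>reduction_surj\<close> and \<open>reduction_kernel\<close>.

  Given a deformation \<open>G\<close> of \<open>\<epsilon>\<^sup>*S\<close>, the descended diagram \<open>F\<close> has \<open>F(x) = G([x])\<close>, and
  \<open>f : x \<rightarrow> y\<close> acts through \<open>G([x]) \<rightarrow> G([x \<rightarrow> y]) \<cong> G([y])\<close>, where the second map is invertible because
  \<open>[y] \<rightarrow> [x \<rightarrow> y]\<close> lies over the identity of \<open>y\<close>. One identity (\<open>leg_descent\<close>) controls everything: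
  for a string \<open>z\<close> and \<open>i \<le> j\<close>, the map \<open>G([z\<^sub>i]) \<rightarrow> G(z)\<close> equals \<open>F(z\<^sub>i \<rightarrow> z\<^sub>j)\<close> followed by
  \<open>G([z\<^sub>j]) \<rightarrow> G(z)\<close>. Applied to a point it shows that \<open>F\<close> respects identities, applied to a triangle
  that \<open>F\<close> respects composition (this is where \<open>k \<ge> 2\<close> enters), and applied to an arbitrary string that
  the isomorphisms \<open>G([z\<^sub>n]) \<rightarrow> G(z)\<close> at last vertices form an isomorphism from \<open>\<epsilon>\<^sup>*F\<close> to \<open>G\<close>. Conversely, an
  isomorphism between pullbacks restricts along points to an isomorphism of the original
  deformations (\<open>eps_defo_reflects_iso\<close>).
\<close>

section \<open>Local Artin rings\<close>

text \<open>Krull's theorem for a principal ideal: the ideals that contain \<open>u\<close> but not \<open>\<one>\<close> are closed under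
  unions of nonempty chains, and \<open>(u)\<close> is one of them, so Zorn's lemma applies.\<close>

lemma (in cring) nonunit_in_maximalideal:
  assumes u: "u \<in> carrier R" "u \<notin> Units R"
  shows "\<exists>M. maximalideal M R \<and> u \<in> M"
proof -
  define Q where "Q = {I. ideal I R \<and> u \<in> I \<and> \<one> \<notin> I}"
  have start: "PIdl u \<in> Q"
  proof -
    have "\<one> \<notin> PIdl u"
    proof
      assume "\<one> \<in> PIdl u"
      then obtain x where "x \<in> carrier R" "\<one> = x \<otimes> u"
        by (auto simp: cgenideal_def)
      then show False
        using u m_comm[of x u] by (auto simp: Units_def)
    qed
    then show ?thesis
      using cgenideal_ideal[OF u(1)] cgenideal_self[OF u(1)] by (simp add: Q_def)
  qed
  have "\<exists>M\<in>Q. \<forall>X\<in>Q. M \<subseteq> X \<longrightarrow> X = M"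
  proof (rule subset_Zorn)
    fix C assume C: "subset.chain Q C"
    show "\<exists>U\<in>Q. \<forall>X\<in>C. X \<subseteq> U"
    proof (cases "C = {}")
      case True
      with start show ?thesis by auto
    next
      case False
      have "subset.chain {I. ideal I R} C"
        using C by (auto simp: pred_on.chain_def Q_def)
      from chain_Union_is_ideal[OF this] False have "ideal (\<Union>C) R"
        by simp
      moreover have "u \<in> \<Union>C" "\<one> \<notin> \<Union>C"
        using C False by (auto simp: pred_on.chain_def Q_def)
      ultimately show ?thesis
        by (intro bexI[of _ "\<Union>C"]) (auto simp: Q_def)
    qed
  qed
  then obtain M where M: "M \<in> Q" "\<And>X. X \<in> Q \<Longrightarrow> M \<subseteq> X \<Longrightarrow> X = M"
    by blast
  have idl: "ideal M R" and "u \<in> M" and "\<one> \<notin> M"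
    using M(1) by (auto simp: Q_def)
  have "maximalideal M R"
  proof (rule maximalidealI[OF idl])
    show "carrier R \<noteq> M"
      using \<open>\<one> \<notin> M\<close> by auto
  next
    fix J assume J: "ideal J R" "M \<subseteq> J" "J \<subseteq> carrier R"
    show "J = M \<or> J = carrier R"
    proof (cases "\<one> \<in> J")
      case True
      then show ?thesis using ideal.one_imp_carrier[OF J(1)] by simp
    next
      case False
      then have "J \<in> Q" using J \<open>u \<in> M\<close> by (auto simp: Q_def)
      then show ?thesis using M(2) J(2) by blast
    qed
  qed
  with \<open>u \<in> M\<close> show ?thesis by blast
qed

locale local_artinian = cring R for R (structure) and I +
  assumes artinian: "artinian R"
    and maximal: "maximalideal I R"
    and maximal_unique: "maximalideal J R \<Longrightarrow> J = I"
begin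

sublocale mx: maximalideal I R
  by (rule maximal)

lemma one_minus_unit:
  assumes "b \<in> I"
  shows "\<one> \<ominus> b \<in> Units R"
proof (rule ccontr)
  assume non: "\<one> \<ominus> b \<notin> Units R"
  have b: "b \<in> carrier R"
    using assms mx.a_subset by auto
  obtain J where "maximalideal J R" "\<one> \<ominus> b \<in> J"
    using nonunit_in_maximalideal[OF _ non] b by auto
  then have "\<one> \<ominus> b \<in> I"
    using maximal_unique by blast
  then have "(\<one> \<ominus> b) \<oplus> b \<in> I"
    using assms mx.a_closed by blast
  moreover have "(\<one> \<ominus> b) \<oplus> b = \<one>"
    using b by algebra
  ultimately show False
    using mx.one_imp_carrier mx.I_notcarr by simp
qed

text \<open>This induction does the work of the nilpotency of the maximal ideal \<open>I\<close>. If \<open>P \<one>\<close> failed,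
  the step would produce factors \<open>b\<^sub>1, b\<^sub>2, \<dots>\<close> in \<open>I\<close> such that \<open>P\<close> fails at every product
  \<open>a\<^sub>n = b\<^sub>1 \<cdots> b\<^sub>n\<close>. The chain of the principal ideals \<open>(a\<^sub>n)\<close> stabilises, say \<open>a\<^sub>n = c b\<^bsub>n+1\<^esub> a\<^sub>n\<close>; since
  \<open>1 - c b\<^bsub>n+1\<^esub>\<close> is a unit, \<open>a\<^sub>n = 0\<close>, where \<open>P\<close> holds.\<close>

lemma descent_induct:
  assumes zero: "P \<zero>"
    and step: "\<And>a. a \<in> carrier R \<Longrightarrow> (\<And>b. b \<in> I \<Longrightarrow> P (a \<otimes> b)) \<Longrightarrow> P a"
  shows "P \<one>"
proof (rule ccontr)
  assume "\<not> P \<one>"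
  have sub: "b \<in> carrier R" if "b \<in> I" for b
    using that mx.a_subset by auto
  have "\<exists>a. \<forall>n. (a n \<in> carrier R \<and> \<not> P (a n)) \<and> (\<exists>b\<in>I. a (Suc n) = a n \<otimes> b)"
  proof (rule dependent_nat_choice)
    show "\<exists>x. x \<in> carrier R \<and> \<not> P x"
      using \<open>\<not> P \<one>\<close> by (intro exI[of _ \<one>]) simp
  next
    fix x and n :: nat assume "x \<in> carrier R \<and> \<not> P x"
    then obtain b where "b \<in> I" "\<not> P (x \<otimes> b)"
      using step[of x] by auto
    then show "\<exists>y. (y \<in> carrier R \<and> \<not> P y) \<and> (\<exists>b\<in>I. y = x \<otimes> b)"
      using sub[of b] \<open>x \<in> carrier R \<and> \<not> P x\<close> by (intro exI[of _ "x \<otimes> b"]) auto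
  qed
  then obtain a where a: "\<And>n. a n \<in> carrier R" "\<And>n. \<not> P (a n)"
    and succ: "\<And>n. \<exists>b\<in>I. a (Suc n) = a n \<otimes> b"
    by (elim exE) (metis (no_types))
  have "\<forall>n. ideal (PIdl (a n)) R \<and> PIdl (a (Suc n)) \<subseteq> PIdl (a n)"
  proof (intro allI conjI)
    fix n
    show "ideal (PIdl (a n)) R"
      using a(1) by (rule cgenideal_ideal)
    obtain b where b: "b \<in> I" "a (Suc n) = a n \<otimes> b" using succ by blast
    then have "a (Suc n) \<in> PIdl (a n)"
      unfolding cgenideal_def using m_comm[OF a(1)[of n] sub[OF b(1)]] sub[OF b(1)] by auto
    then show "PIdl (a (Suc n)) \<subseteq> PIdl (a n)"
      using cgenideal_minimal[OF cgenideal_ideal[OF a(1)]] by blast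
  qed
  with artinian obtain n where n: "\<And>m. m \<ge> n \<Longrightarrow> PIdl (a m) = PIdl (a n)"
    unfolding artinian_def by (elim allE[of _ "\<lambda>n. PIdl (a n)"] impE exE) auto
  have "a n \<in> PIdl (a (Suc n))"
    using n[of "Suc n"] cgenideal_self[OF a(1)[of n]] by simp
  then obtain c where c: "c \<in> carrier R" "a n = c \<otimes> a (Suc n)"
    by (auto simp: cgenideal_def)
  obtain b where b: "b \<in> I" "a (Suc n) = a n \<otimes> b" using succ by blast
  have an: "a n \<in> carrier R" and bc: "b \<in> carrier R" using a(1) sub b by auto
  have u: "\<one> \<ominus> c \<otimes> b \<in> Units R"
    using one_minus_unit mx.I_l_closed[OF b(1) c(1)] by blast
  have "(\<one> \<ominus> c \<otimes> b) \<otimes> a n = a n \<ominus> c \<otimes> (a n \<otimes> b)"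
    using an bc c(1) by algebra
  also have "\<dots> = \<zero>"
    unfolding b(2)[symmetric] c(2)[symmetric] a_minus_def using an by (rule r_neg)
  finally have "(\<one> \<ominus> c \<otimes> b) \<otimes> a n = (\<one> \<ominus> c \<otimes> b) \<otimes> \<zero>"
    using r_null[OF Units_closed[OF u]] by simp
  then have "a n = \<zero>"
    using Units_l_cancel[OF u an] by simp
  with zero a(2)[of n] show False by simp
qed

end

section \<open>Nakayama's lemma\<close>

text \<open>The submodule \<open>I V\<close>. Taking the additive group generated by the products is enough when \<open>I\<close> is an
  ideal, because the products are then stable under scalars.\<close>

definition ideal_times :: "('a, 'b) module \<Rightarrow> 'a set \<Rightarrow> 'b set \<Rightarrow> 'b set" where
  "ideal_times M I V = generate (add_monoid M) {a \<odot>\<^bsub>M\<^esub> v | a v. a \<in> I \<and> v \<in> V}"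

text \<open>If \<open>V \<subseteq> W + I V\<close> then \<open>V \<subseteq> W\<close>. The
  claim \<open>a V \<subseteq> W\<close> for \<open>a = \<one>\<close> follows by the induction above, since \<open>a V \<subseteq> a W + a I V\<close> and \<open>a I V\<close> is
  spanned by the sets \<open>(a b) V\<close> with \<open>b \<in> I\<close>. The relative form covers both uses below: \<open>W\<close> is the
  image of a map and \<open>V\<close> its codomain, or \<open>W\<close> is zero and \<open>V\<close> a kernel.\<close>

lemma (in local_artinian) nakayama:
  assumes "Module.module R M" and "submodule W R M" and V: "V \<subseteq> carrier M"
    and decomp: "\<And>v. v \<in> V \<Longrightarrow> \<exists>w\<in>W. \<exists>y\<in>ideal_times M I V. v = w \<oplus>\<^bsub>M\<^esub> y"
  shows "V \<subseteq> W"
proof -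
  interpret M: Module.module R M by fact
  interpret W: submodule W R M by fact
  have "\<forall>v\<in>V. \<one> \<odot>\<^bsub>M\<^esub> v \<in> W"
  proof (rule descent_induct)
    show "\<forall>v\<in>V. \<zero> \<odot>\<^bsub>M\<^esub> v \<in> W"
      using V W.one_closed by auto
  next
    fix a assume a: "a \<in> carrier R" and IH: "\<And>b. b \<in> I \<Longrightarrow> \<forall>v\<in>V. (a \<otimes> b) \<odot>\<^bsub>M\<^esub> v \<in> W"
    have gen: "y \<in> carrier M \<and> a \<odot>\<^bsub>M\<^esub> y \<in> W" if "y \<in> ideal_times M I V" for y
      using that unfolding ideal_times_def
    proof (induction rule: generate.induct)
      case one
      then show ?case using a W.one_closed by simp
    next
      case (incl h)
      then obtain b v where "h = b \<odot>\<^bsub>M\<^esub> v" "b \<in> I" "v \<in> V" by blast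
      moreover have "b \<in> carrier R" "v \<in> carrier M"
        using calculation mx.a_subset V by auto
      ultimately show ?case using IH[of b] a by (auto simp: M.smult_assoc1)
    next
      case (inv h)
      then obtain b v where h: "h = b \<odot>\<^bsub>M\<^esub> v" "b \<in> I" "v \<in> V" by blast
      moreover have bv: "b \<in> carrier R" "v \<in> carrier M"
        using calculation mx.a_subset V by auto
      ultimately have "a \<odot>\<^bsub>M\<^esub> h \<in> W" "h \<in> carrier M"
        using IH[of b] a by (auto simp: M.smult_assoc1)
      then have "\<ominus>\<^bsub>M\<^esub> (a \<odot>\<^bsub>M\<^esub> h) \<in> W" "a \<odot>\<^bsub>M\<^esub> (\<ominus>\<^bsub>M\<^esub> h) = \<ominus>\<^bsub>M\<^esub> (a \<odot>\<^bsub>M\<^esub> h)"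
        using W.m_inv_closed a M.smult_r_minus by (auto simp: a_inv_def)
      then show ?case
        using \<open>h \<in> carrier M\<close> by (simp flip: a_inv_def)
    next
      case (eng h1 h2)
      then show ?case
        using a W.m_closed by (simp add: M.smult_r_distr)
    qed
    show "\<forall>v\<in>V. a \<odot>\<^bsub>M\<^esub> v \<in> W"
    proof
      fix v assume "v \<in> V"
      then obtain w y where wy: "w \<in> W" "y \<in> ideal_times M I V" "v = w \<oplus>\<^bsub>M\<^esub> y"
        using decomp by blast
      moreover have "w \<in> carrier M"
        using wy(1) W.subset by auto
      ultimately show "a \<odot>\<^bsub>M\<^esub> v \<in> W"
        using gen[OF wy(2)] a W.smult_closed W.m_closed by (auto simp: M.smult_r_distr)
    qed
  qed
  then show ?thesis using V by (metis M.smult_one subset_iff)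
qed

section \<open>Maps out of tensor products\<close>

text \<open>Elements of the tensor product are cosets of the subgroup of those formal sums of pairs that vanish
  in it, so computations are done with formal sums modulo this subgroup.\<close>

abbreviation tensor_null ::
  "('a, 'z) ring_scheme \<Rightarrow> ('a, 'b) module \<Rightarrow> ('a, 'c) module \<Rightarrow> (('b \<times> 'c) \<Rightarrow>\<^sub>0 int) set" where
  "tensor_null A M N \<equiv> generate (tensor_free M N) (tensor_relators A M N)"

lemma tensor_relators_subset:
  assumes "Module.module A M" and "Module.module A N"
  shows "tensor_relators A M N \<subseteq> carrier (tensor_free M N)"
proof -
  interpret M: Module.module A M by fact
  interpret N: Module.module A N by fact
  have d: "Poly_Mapping.keys (p - q) \<subseteq> S"
    if "Poly_Mapping.keys p \<subseteq> S" "Poly_Mapping.keys q \<subseteq> S" for p q :: "'x \<Rightarrow>\<^sub>0 int" and S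
    using that keys_diff[of p q] by auto
  show ?thesis
    unfolding tensor_relators_def tensor_free_def
    by (intro Un_least subsetI; elim CollectE exE conjE; simp only: carrier_free_Abelian_group_iff; intro d)
      simp_all
qed

lemma tensor_null_subgroup:
  assumes "Module.module A M" and "Module.module A N"
  shows "subgroup (tensor_null A M N) (tensor_free M N)"
  using group.generate_is_subgroup[OF _ tensor_relators_subset[OF assms]]
  by (simp add: tensor_free_def)

lemma tensor_coset_eq_iff:
  assumes "Module.module A M" and "Module.module A N"
    and p: "p \<in> carrier (tensor_free M N)" and q: "q \<in> carrier (tensor_free M N)"
  shows "tensor_coset A M N p = tensor_coset A M N q \<longleftrightarrow> p - q \<in> tensor_null A M N"
proof -
  have G: "group (tensor_free M N)" by (simp add: tensor_free_def)
  note H = tensor_null_subgroup[OF assms(1,2)]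
  have "p \<in> tensor_null A M N #>\<^bsub>tensor_free M N\<^esub> q \<longleftrightarrow> p - q \<in> tensor_null A M N"
    using subgroup.rcos_module[OF H G q p] q by (simp add: tensor_free_def)
  then show ?thesis
    unfolding tensor_coset_def
    using group.repr_independence[OF G _ q H] group.rcos_self[OF G p H] by metis
qed

lemma tensor_relators_cases:
  assumes "r \<in> tensor_relators A M N"
  obtains (left) x x' y where "r = frag_of (x \<oplus>\<^bsub>M\<^esub> x', y) - frag_of (x, y) - frag_of (x', y)"
      "x \<in> carrier M" "x' \<in> carrier M" "y \<in> carrier N"
    | (right) x y y' where "r = frag_of (x, y \<oplus>\<^bsub>N\<^esub> y') - frag_of (x, y) - frag_of (x, y')"
      "x \<in> carrier M" "y \<in> carrier N" "y' \<in> carrier N"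
    | (middle) a x y where "r = frag_of (a \<odot>\<^bsub>M\<^esub> x, y) - frag_of (x, a \<odot>\<^bsub>N\<^esub> y)"
      "a \<in> carrier A" "x \<in> carrier M" "y \<in> carrier N"
  using assms unfolding tensor_relators_def by blast

lemma tensor_null_incl: "r \<in> tensor_relators A M N \<Longrightarrow> r \<in> tensor_null A M N"
  by (rule generate.incl)

lemma tensor_null_right:
  "x \<in> carrier M \<Longrightarrow> y \<in> carrier N \<Longrightarrow> y' \<in> carrier N \<Longrightarrow>
    frag_of (x, y \<oplus>\<^bsub>N\<^esub> y') - frag_of (x, y) - frag_of (x, y') \<in> tensor_null A M N"
  by (rule tensor_null_incl) (unfold tensor_relators_def, blast)

lemma tensor_null_middle:
  "a \<in> carrier A \<Longrightarrow> x \<in> carrier M \<Longrightarrow> y \<in> carrier N \<Longrightarrow>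
    frag_of (a \<odot>\<^bsub>M\<^esub> x, y) - frag_of (x, a \<odot>\<^bsub>N\<^esub> y) \<in> tensor_null A M N"
  by (rule tensor_null_incl) (unfold tensor_relators_def, blast)

lemma tensor_null_zero: "0 \<in> tensor_null A M N"
  using generate.one[of "tensor_free M N"] by (simp add: tensor_free_def)

lemma tensor_null_add:
  "p \<in> tensor_null A M N \<Longrightarrow> q \<in> tensor_null A M N \<Longrightarrow> p + q \<in> tensor_null A M N"
  using generate.eng[of p "tensor_free M N" _ q] by (simp add: tensor_free_def)

lemma tensor_null_diff:
  assumes "Module.module A M" and "Module.module A N"
    and "p \<in> tensor_null A M N" and "q \<in> tensor_null A M N"
  shows "p - q \<in> tensor_null A M N"
proof -
  note H = tensor_null_subgroup[OF assms(1,2)]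
  have "q \<in> carrier (tensor_free M N)"
    using subgroup.subset[OF H] assms(4) by blast
  then have "- q \<in> tensor_null A M N"
    using subgroup.m_inv_closed[OF H assms(4)] by (simp add: tensor_free_def)
  from tensor_null_add[OF assms(3) this] show ?thesis by simp
qed

lemma free_hom_frag:
  assumes "abelian_group L" and E: "E \<in> hom (free_Abelian_group S) (add_monoid L)"
  shows "E 0 = \<zero>\<^bsub>L\<^esub>"
    and "Poly_Mapping.keys p \<subseteq> S \<Longrightarrow> E p \<in> carrier L"
    and "Poly_Mapping.keys p \<subseteq> S \<Longrightarrow> Poly_Mapping.keys q \<subseteq> S \<Longrightarrow> E (p - q) = E p \<ominus>\<^bsub>L\<^esub> E q"
proof -
  interpret L: abelian_group L by fact
  have h: "group_hom (free_Abelian_group S) (add_monoid L) E"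
    using E L.a_group by (simp add: group_hom_def group_hom_axioms_def)
  then show "E 0 = \<zero>\<^bsub>L\<^esub>"
    using group_hom.hom_one[OF h] by simp
  show "E p \<in> carrier L" if "Poly_Mapping.keys p \<subseteq> S" for p
    using hom_in_carrier[OF E, of p] that by simp
  assume pq: "Poly_Mapping.keys p \<subseteq> S" "Poly_Mapping.keys q \<subseteq> S"
  have "E (p + (- q)) = E p \<oplus>\<^bsub>L\<^esub> E (- q)"
    using hom_mult[OF E, of p "- q"] pq by simp
  also have "E (- q) = \<ominus>\<^bsub>L\<^esub> (E q)"
    using group_hom.hom_inv[OF h, of q] pq by (simp add: a_inv_def)
  finally show "E (p - q) = E p \<ominus>\<^bsub>L\<^esub> E q"
    by (simp add: a_minus_def)
qed

lemma tensor_eval: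
  fixes u :: "'b \<Rightarrow> 'c \<Rightarrow> 'd" and L :: "('d, 'y) ring_scheme"
  assumes "abelian_group L" and u: "\<And>x y. x \<in> X \<Longrightarrow> y \<in> Y \<Longrightarrow> u x y \<in> carrier L"
  obtains E where "E \<in> hom (free_Abelian_group (X \<times> Y)) (add_monoid L)"
    and "\<And>x y. x \<in> X \<Longrightarrow> y \<in> Y \<Longrightarrow> E (frag_of (x, y)) = u x y"
proof -
  interpret L: abelian_group L by fact
  have "(\<lambda>(x, y). u x y) ` (X \<times> Y) \<subseteq> carrier (add_monoid L)"
    using u by auto
  from comm_group.free_Abelian_group_universal[OF L.a_comm_group this]
  obtain E where "E \<in> hom (free_Abelian_group (X \<times> Y)) (add_monoid L)"
    "\<And>z. z \<in> X \<times> Y \<Longrightarrow> E (frag_of z) = (case z of (x, y) \<Rightarrow> u x y)"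
    by blast
  then show thesis using that by auto
qed

text \<open>The universal property of the tensor product in a relative form: \<open>u\<close> has to be bilinear only modulo
  a subgroup \<open>W\<close>, and then formal sums that vanish in \<open>M \<otimes>\<^sub>A N\<close> are evaluated into \<open>W\<close>. This gives maps
  from \<open>M \<otimes>\<^sub>A N\<close> to \<open>L/W\<close> without forming the quotient.\<close>

lemma tensor_null_eval:
  fixes u :: "'b \<Rightarrow> 'c \<Rightarrow> 'd" and L :: "('d, 'y) ring_scheme"
  assumes "Module.module A M" and "Module.module A N" and "abelian_group L"
    and E: "E \<in> hom (free_Abelian_group (carrier M \<times> carrier N)) (add_monoid L)"
    and Eu: "\<And>x y. x \<in> carrier M \<Longrightarrow> y \<in> carrier N \<Longrightarrow> E (frag_of (x, y)) = u x y"
    and W: "subgroup W (add_monoid L)"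
    and left: "\<And>x x' y. x \<in> carrier M \<Longrightarrow> x' \<in> carrier M \<Longrightarrow> y \<in> carrier N \<Longrightarrow>
      u (x \<oplus>\<^bsub>M\<^esub> x') y \<ominus>\<^bsub>L\<^esub> u x y \<ominus>\<^bsub>L\<^esub> u x' y \<in> W"
    and right: "\<And>x y y'. x \<in> carrier M \<Longrightarrow> y \<in> carrier N \<Longrightarrow> y' \<in> carrier N \<Longrightarrow>
      u x (y \<oplus>\<^bsub>N\<^esub> y') \<ominus>\<^bsub>L\<^esub> u x y \<ominus>\<^bsub>L\<^esub> u x y' \<in> W"
    and middle: "\<And>a x y. a \<in> carrier A \<Longrightarrow> x \<in> carrier M \<Longrightarrow> y \<in> carrier N \<Longrightarrow>
      u (a \<odot>\<^bsub>M\<^esub> x) y \<ominus>\<^bsub>L\<^esub> u x (a \<odot>\<^bsub>N\<^esub> y) \<in> W"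
    and p: "p \<in> tensor_null A M N"
  shows "E p \<in> W"
proof -
  interpret L: abelian_group L by fact
  interpret M: Module.module A M by fact
  interpret N: Module.module A N by fact
  let ?F = "free_Abelian_group (carrier M \<times> carrier N)"
  have h: "group_hom ?F (add_monoid L) E"
    using E L.a_group by (simp add: group_hom_def group_hom_axioms_def)
  note E_simps = free_hom_frag[OF assms(3) E]
  have d: "Poly_Mapping.keys (p - q) \<subseteq> S"
    if "Poly_Mapping.keys p \<subseteq> S" "Poly_Mapping.keys q \<subseteq> S" for p q :: "'b \<times> 'c \<Rightarrow>\<^sub>0 int" and S
    using that keys_diff[of p q] by auto
  have rel: "E r \<in> W" if "r \<in> tensor_relators A M N" for r
    using that
  proof (cases rule: tensor_relators_cases)
    case (left x x' y)
    then show ?thesis using assms(7)[of x x' y] by (simp add: E_simps d Eu)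
  next
    case (right x y y')
    then show ?thesis using assms(8)[of x y y'] by (simp add: E_simps d Eu)
  next
    case (middle a x y)
    then show ?thesis using assms(9)[of a x y] by (simp add: E_simps d Eu)
  qed
  have sub: "tensor_relators A M N \<subseteq> carrier ?F"
    using tensor_relators_subset[OF assms(1,2)] by (simp add: tensor_free_def)
  have "p \<in> generate ?F (tensor_relators A M N)"
    using p by (simp add: tensor_free_def)
  then show ?thesis
  proof (induction rule: generate.induct)
    case one
    then show ?case using E_simps(1) subgroup.one_closed[OF W] by simp
  next
    case (incl h)
    then show ?case by (rule rel)
  next
    case (inv r)
    then have "E (inv\<^bsub>?F\<^esub> r) = inv\<^bsub>add_monoid L\<^esub> (E r)"
      using group_hom.hom_inv[OF h] sub by blast
    then show ?case using rel[OF inv] subgroup.m_inv_closed[OF W] by metis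
  next
    case (eng h1 h2)
    have "h1 \<in> carrier ?F" "h2 \<in> carrier ?F"
      using eng(1,2) group.generate_in_carrier[OF _ sub] by auto
    then have "E (h1 \<otimes>\<^bsub>?F\<^esub> h2) = E h1 \<otimes>\<^bsub>add_monoid L\<^esub> E h2"
      using hom_mult[OF E] by blast
    then show ?case using eng subgroup.m_closed[OF W] by metis
  qed
qed

section \<open>Relations in flat modules\<close>

definition ideal_module :: "('a, 'z) ring_scheme \<Rightarrow> 'a set \<Rightarrow> ('a, 'a) module" where
  "ideal_module A I = \<lparr> carrier = I, monoid.mult = monoid.mult A, one = one A,
     ring.zero = ring.zero A, add = add A, smult = monoid.mult A \<rparr>"

lemma ideal_module_simps [simp]:
  "carrier (ideal_module A I) = I" "add (ideal_module A I) = add A"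
  "ring.zero (ideal_module A I) = ring.zero A" "smult (ideal_module A I) = monoid.mult A"
  by (simp_all add: ideal_module_def)

lemma module_ideal_module:
  assumes "cring A" and "ideal I A"
  shows "Module.module A (ideal_module A I)"
proof -
  interpret A: cring A by fact
  interpret I: ideal I A by fact
  have sub: "x \<in> carrier A" if "x \<in> I" for x using that I.a_subset by auto
  have "abelian_group (ideal_module A I)"
  proof (rule abelian_groupI; simp)
    show "\<exists>y\<in>I. y \<oplus>\<^bsub>A\<^esub> x = \<zero>\<^bsub>A\<^esub>" if "x \<in> I" for x
      using that sub A.l_neg I.a_inv_closed by blast
  qed (use sub A.a_assoc A.a_comm in auto)
  then show ?thesis
    by (rule moduleI[OF assms(1)]) (use sub in \<open>auto simp: A.l_distr A.r_distr A.m_assoc I.I_l_closed\<close>)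
qed

text \<open>If \<open>\<Sum> a\<^sub>i n\<^sub>i = 0\<close> in a flat module \<open>N\<close>, with all \<open>a\<^sub>i\<close> in an ideal \<open>I\<close>, then \<open>\<Sum> a\<^sub>i \<otimes> n\<^sub>i\<close> already
  vanishes in \<open>I \<otimes>\<^sub>A N\<close>. Indeed its image in \<open>A \<otimes>\<^sub>A N\<close> is \<open>1 \<otimes> \<Sum> a\<^sub>i n\<^sub>i = 0\<close>, and flatness makes
  \<open>I \<otimes>\<^sub>A N \<rightarrow> A \<otimes>\<^sub>A N\<close> injective. The formal sum is \<open>p\<close>, and \<open>E\<close> evaluates formal sums in \<open>N\<close>.\<close>

lemma flat_relation:
  assumes N: "flat A N" and I: "ideal I A"
    and p: "p \<in> carrier (tensor_free (ideal_module A I) N)"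
    and E: "E \<in> hom (free_Abelian_group (I \<times> carrier N)) (add_monoid N)"
    and Eu: "\<And>a n. a \<in> I \<Longrightarrow> n \<in> carrier N \<Longrightarrow> E (frag_of (a, n)) = a \<odot>\<^bsub>N\<^esub> n"
    and null: "E p = \<zero>\<^bsub>N\<^esub>"
  shows "p \<in> tensor_null A (ideal_module A I) N"
proof -
  have modN: "Module.module A N" using N by (simp add: flat_def)
  interpret N: Module.module A N by (rule modN)
  interpret I: ideal I A by (rule I)
  define P where "P = ideal_module A I"
  define Q where "Q = ideal_module A (carrier A)"
  have modP: "Module.module A P" and modQ: "Module.module A Q"
    unfolding P_def Q_def
    by (auto intro!: module_ideal_module I N.R.is_cring N.R.oneideal)
  note E_simps = free_hom_frag[OF N.M.abelian_group_axioms E]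
  have IA: "a \<in> carrier A" if "a \<in> I" for a using that I.a_subset by auto
  \<comment> \<open>The relator \<open>1 \<otimes> (0 + 0) - 1 \<otimes> 0 - 1 \<otimes> 0\<close> is \<open>- (1 \<otimes> 0)\<close>.\<close>
  have zeroQ: "frag_of (\<one>\<^bsub>A\<^esub>, \<zero>\<^bsub>N\<^esub>) \<in> tensor_null A Q N"
  proof -
    have "frag_of (\<one>\<^bsub>A\<^esub>, \<zero>\<^bsub>N\<^esub>) - frag_of (\<one>\<^bsub>A\<^esub>, \<zero>\<^bsub>N\<^esub>) - frag_of (\<one>\<^bsub>A\<^esub>, \<zero>\<^bsub>N\<^esub>) \<in> tensor_null A Q N"
      using tensor_null_right[of "\<one>\<^bsub>A\<^esub>" Q "\<zero>\<^bsub>N\<^esub>" N "\<zero>\<^bsub>N\<^esub>" A] by (simp add: Q_def)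
    from tensor_null_diff[OF modQ modN tensor_null_zero this] show ?thesis
      by simp
  qed
  \<comment> \<open>In \<open>A \<otimes>\<^sub>A N\<close> every formal sum is the single tensor of \<open>1\<close> with its value.\<close>
  have key: "q - frag_of (\<one>\<^bsub>A\<^esub>, E q) \<in> tensor_null A Q N"
    if "Poly_Mapping.keys q \<subseteq> I \<times> carrier N" for q
  proof (rule free_Abelian_group_induct[OF that])
    show "0 - frag_of (\<one>\<^bsub>A\<^esub>, E 0) \<in> tensor_null A Q N"
      using tensor_null_diff[OF modQ modN tensor_null_zero zeroQ] by (simp add: E_simps)
  next
    fix x y
    assume 2: "Poly_Mapping.keys x \<subseteq> I \<times> carrier N" "Poly_Mapping.keys y \<subseteq> I \<times> carrier N"
      "x - frag_of (\<one>\<^bsub>A\<^esub>, E x) \<in> tensor_null A Q N" "y - frag_of (\<one>\<^bsub>A\<^esub>, E y) \<in> tensor_null A Q N"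
    have c: "E x \<in> carrier N" "E y \<in> carrier N" using 2(1,2) E_simps(2) by auto
    have "frag_of (\<one>\<^bsub>A\<^esub>, E (x - y) \<oplus>\<^bsub>N\<^esub> E y) - frag_of (\<one>\<^bsub>A\<^esub>, E (x - y)) - frag_of (\<one>\<^bsub>A\<^esub>, E y)
        \<in> tensor_null A Q N"
      by (rule tensor_null_right) (use c E_simps(3)[OF 2(1,2)] in \<open>simp_all add: Q_def\<close>)
    moreover have "E (x - y) \<oplus>\<^bsub>N\<^esub> E y = E x"
      using c E_simps(3)[OF 2(1,2)] by (simp add: a_minus_def N.a_assoc N.l_neg)
    ultimately have "frag_of (\<one>\<^bsub>A\<^esub>, E x) - frag_of (\<one>\<^bsub>A\<^esub>, E (x - y)) - frag_of (\<one>\<^bsub>A\<^esub>, E y)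
        \<in> tensor_null A Q N" by simp
    from tensor_null_add[OF tensor_null_diff[OF modQ modN 2(3,4)] this]
    show "x - y - frag_of (\<one>\<^bsub>A\<^esub>, E (x - y)) \<in> tensor_null A Q N" by (simp add: algebra_simps)
  next
    fix z assume "z \<in> I \<times> carrier N"
    then obtain a n where z: "z = (a, n)" "a \<in> I" "n \<in> carrier N" by auto
    have "frag_of (a \<otimes>\<^bsub>A\<^esub> \<one>\<^bsub>A\<^esub>, n) - frag_of (\<one>\<^bsub>A\<^esub>, a \<odot>\<^bsub>N\<^esub> n) \<in> tensor_null A Q N"
      using tensor_null_middle[of a A "\<one>\<^bsub>A\<^esub>" Q n N] z IA by (simp add: Q_def)
    then show "frag_of z - frag_of (\<one>\<^bsub>A\<^esub>, E (frag_of z)) \<in> tensor_null A Q N" using z IA Eu by simp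
  qed
  have "p \<in> tensor_null A Q N"
    using tensor_null_add[OF key zeroQ, of p] p null by (simp add: tensor_free_def)
  have PQ: "tensor_null A P N \<subseteq> tensor_null A Q N"
  proof -
    have "tensor_relators A P N \<subseteq> tensor_relators A Q N"
      unfolding tensor_relators_def P_def Q_def using IA by (simp; fast)
    then have "tensor_relators A P N \<subseteq> tensor_null A Q N"
      using tensor_null_incl by blast
    have "generate (tensor_free P N) (tensor_relators A P N) \<subseteq> tensor_null A Q N"
    proof
      fix r assume "r \<in> generate (tensor_free P N) (tensor_relators A P N)"
      then show "r \<in> tensor_null A Q N"
      proof (induction rule: generate.induct)
        case one
        then show ?case using tensor_null_zero by (simp add: tensor_free_def)
      next
        case (incl h)
        then show ?case using \<open>tensor_relators A P N \<subseteq> tensor_null A Q N\<close> by blast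
      next
        case (inv h)
        then have "h \<in> tensor_null A Q N" "h \<in> carrier (tensor_free P N)"
          using \<open>tensor_relators A P N \<subseteq> tensor_null A Q N\<close> tensor_relators_subset[OF modP modN] by auto
        then show ?case
          using tensor_null_diff[OF modQ modN tensor_null_zero \<open>h \<in> tensor_null A Q N\<close>]
          by (simp add: tensor_free_def)
      next
        case (eng h1 h2)
        then show ?case using tensor_null_add[of h1 Q N A h2] by (simp add: tensor_free_def)
      qed
    qed
    then show ?thesis .
  qed
  have pc: "p \<in> carrier (tensor_free P N)" and p0: "0 \<in> carrier (tensor_free P N)"
    using p by (simp_all add: tensor_free_def P_def)
  have image: "tensor_map A Q N (\<lambda>x. x) (\<lambda>x. x) (tensor_coset A P N q) = tensor_coset A Q N 0"
    if q: "q \<in> carrier (tensor_free P N)" "q \<in> tensor_null A Q N" for q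
  proof -
    have id: "frag_extend (\<lambda>(x, y). frag_of (x, y)) r = r" for r :: "'a \<times> 'c \<Rightarrow>\<^sub>0 int"
    proof -
      have "(\<lambda>(x, y). frag_of (x, y)) = (frag_of :: 'a \<times> 'c \<Rightarrow> _)" by auto
      then show ?thesis using frag_expansion[of r] by metis
    qed
    have mult: "s \<otimes>\<^bsub>tensor_free P N\<^esub> t = s + t" for s t
      by (simp add: tensor_free_def)
    have "tensor_coset A Q N r = tensor_coset A Q N 0" if rq: "r \<in> tensor_coset A P N q" for r
    proof -
      obtain s where s: "s \<in> tensor_null A P N" "r = s + q"
        using rq unfolding tensor_coset_def r_coset_def mult by blast
      then have r: "r \<in> tensor_null A Q N"
        using PQ q(2) tensor_null_add by blast
      moreover have "r \<in> carrier (tensor_free Q N)"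
        using r subgroup.subset[OF tensor_null_subgroup[OF modQ modN]] by blast
      ultimately show ?thesis
        using tensor_coset_eq_iff[OF modQ modN, of r 0] by (simp add: tensor_free_def)
    qed
    moreover have "tensor_coset A P N q \<noteq> {}"
      using group.rcos_self[OF _ q(1) tensor_null_subgroup[OF modP modN]]
      by (auto simp: tensor_coset_def tensor_free_def)
    ultimately show ?thesis
      unfolding tensor_map_def id by auto
  qed
  have "(\<lambda>x. x) \<in> lin_hom A P Q"
    using IA by (auto simp: lin_hom_def P_def Q_def)
  then have inj: "inj_on (tensor_map A Q N (\<lambda>x. x) (\<lambda>x. x)) (carrier (tensor A P N))"
    using N modP modQ unfolding flat_def by (metis inj_on_id2)
  have "tensor_coset A P N p = tensor_coset A P N 0"
  proof (rule inj_onD[OF inj])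
    show "tensor_map A Q N (\<lambda>x. x) (\<lambda>x. x) (tensor_coset A P N p) =
        tensor_map A Q N (\<lambda>x. x) (\<lambda>x. x) (tensor_coset A P N 0)"
      using image[OF pc \<open>p \<in> tensor_null A Q N\<close>] image[OF p0 tensor_null_zero] by simp
  qed (use pc p0 in \<open>auto simp: tensor_def\<close>)
  then show ?thesis
    using tensor_coset_eq_iff[OF modP modN pc p0] by (simp add: P_def)
qed

lemma ideal_times_subgroup:
  assumes "Module.module A M" and "I \<subseteq> carrier A" and "V \<subseteq> carrier M"
  shows "subgroup (ideal_times M I V) (add_monoid M)"
proof -
  interpret M: Module.module A M by fact
  have "{a \<odot>\<^bsub>M\<^esub> v | a v. a \<in> I \<and> v \<in> V} \<subseteq> carrier (add_monoid M)"
    using assms(2,3) by auto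
  then show ?thesis
    unfolding ideal_times_def using group.generate_is_subgroup[OF M.M.a_group] by simp
qed

lemma ideal_times_incl: "a \<in> I \<Longrightarrow> v \<in> V \<Longrightarrow> a \<odot>\<^bsub>M\<^esub> v \<in> ideal_times M I V"
  unfolding ideal_times_def by (rule generate.incl) blast

lemma ideal_times_repr:
  assumes "Module.module A M" and I: "I \<subseteq> carrier A"
    and E: "E \<in> hom (free_Abelian_group (I \<times> carrier M)) (add_monoid M)"
    and Eu: "\<And>a y. a \<in> I \<Longrightarrow> y \<in> carrier M \<Longrightarrow> E (frag_of (a, y)) = a \<odot>\<^bsub>M\<^esub> y"
    and x: "x \<in> ideal_times M I (carrier M)"
  shows "\<exists>p. Poly_Mapping.keys p \<subseteq> I \<times> carrier M \<and> E p = x"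
proof -
  interpret M: Module.module A M by fact
  let ?F = "free_Abelian_group (I \<times> carrier M)"
  have h: "group_hom ?F (add_monoid M) E"
    using E M.M.a_group by (simp add: group_hom_def group_hom_axioms_def)
  have "subgroup (E ` carrier ?F) (add_monoid M)"
    using group_hom.img_is_subgroup[OF h] .
  moreover have "{a \<odot>\<^bsub>M\<^esub> y | a y. a \<in> I \<and> y \<in> carrier M} \<subseteq> E ` carrier ?F"
  proof safe
    fix a y assume "a \<in> I" "y \<in> carrier M"
    then have "E (frag_of (a, y)) = a \<odot>\<^bsub>M\<^esub> y" "frag_of (a, y) \<in> carrier ?F"
      using Eu by auto
    then show "a \<odot>\<^bsub>M\<^esub> y \<in> E ` carrier ?F" by (metis imageI)
  qed
  ultimately have "ideal_times M I (carrier M) \<subseteq> E ` carrier ?F"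
    unfolding ideal_times_def using group.generate_subgroup_incl[OF M.M.a_group] by blast
  with x have "x \<in> E ` carrier ?F" by blast
  then show ?thesis by (elim imageE) auto
qed

lemma lin_hom_group_hom:
  assumes "Module.module A M" and "Module.module A N" and f: "f \<in> lin_hom A M N"
  shows "group_hom (add_monoid M) (add_monoid N) f"
proof -
  interpret M: Module.module A M by fact
  interpret N: Module.module A N by fact
  show ?thesis
    using f M.M.a_group N.M.a_group
    by (auto simp: group_hom_def group_hom_axioms_def lin_hom_def hom_def)
qed

lemma lin_hom_zero:
  assumes "Module.module A M" and "Module.module A N" and "f \<in> lin_hom A M N"
  shows "f \<zero>\<^bsub>M\<^esub> = \<zero>\<^bsub>N\<^esub>"
  using group_hom.hom_one[OF lin_hom_group_hom[OF assms]] by simp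

lemma lin_hom_diff:
  assumes "Module.module A M" and "Module.module A N" and f: "f \<in> lin_hom A M N"
    and x: "x \<in> carrier M" and y: "y \<in> carrier M"
  shows "f (x \<ominus>\<^bsub>M\<^esub> y) = f x \<ominus>\<^bsub>N\<^esub> f y"
proof -
  interpret M: Module.module A M by fact
  have "f (x \<ominus>\<^bsub>M\<^esub> y) = f x \<oplus>\<^bsub>N\<^esub> f (\<ominus>\<^bsub>M\<^esub> y)"
    using f x y by (simp add: lin_hom_def a_minus_def)
  then show ?thesis
    using group_hom.hom_inv[OF lin_hom_group_hom[OF assms(1-3)], of y] y
    by (simp add: a_minus_def a_inv_def)
qed

text \<open>For a surjection \<open>f : M \<rightarrow> N\<close> with kernel \<open>L\<close> and \<open>N\<close> flat, \<open>L \<inter> I M = I L\<close>; in homological terms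
  this is the vanishing of \<open>Tor\<^sub>1(N, A/I)\<close>. Write \<open>x = \<Sum> a\<^sub>i y\<^sub>i\<close> with \<open>a\<^sub>i \<in> I\<close>. As
  \<open>\<Sum> a\<^sub>i f(y\<^sub>i) = 0\<close>, the previous lemma shows that \<open>\<Sum> a\<^sub>i \<otimes> f(y\<^sub>i)\<close> vanishes in \<open>I \<otimes>\<^sub>A N\<close>. If
  \<open>g\<close> is a set-theoretic section of \<open>f\<close>, then \<open>(a, n) \<mapsto> a g(n)\<close> is bilinear modulo \<open>I L\<close>, hence
  \<open>\<Sum> a\<^sub>i g(f(y\<^sub>i)) \<in> I L\<close>; and this sum differs from \<open>x\<close> by an element of \<open>I L\<close>.\<close>

lemma flat_kernel:
  fixes M :: "('a, 'b) module" and N :: "('a, 'c) module"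
  assumes M: "Module.module A M" and N: "flat A N" and f: "f \<in> lin_hom A M N"
    and surj: "f ` carrier M = carrier N" and I: "ideal I A"
    and x: "x \<in> ideal_times M I (carrier M)" and fx: "f x = \<zero>\<^bsub>N\<^esub>"
  shows "x \<in> ideal_times M I {l \<in> carrier M. f l = \<zero>\<^bsub>N\<^esub>}"
proof -
  have modN: "Module.module A N" using N by (simp add: flat_def)
  interpret M: Module.module A M by fact
  interpret N: Module.module A N by (rule modN)
  interpret I: ideal I A by fact
  have IA: "a \<in> carrier A" if "a \<in> I" for a using that I.a_subset by auto
  have fc: "f y \<in> carrier N" if "y \<in> carrier M" for y using f that by (auto simp: lin_hom_def)
  define L where "L = {l \<in> carrier M. f l = \<zero>\<^bsub>N\<^esub>}"
  have W: "subgroup (ideal_times M I L) (add_monoid M)"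
    by (rule ideal_times_subgroup[OF M]) (auto simp: L_def IA)
  have Wz: "\<zero>\<^bsub>M\<^esub> \<in> ideal_times M I L" using subgroup.one_closed[OF W] by simp
  have Wadd: "u \<oplus>\<^bsub>M\<^esub> v \<in> ideal_times M I L" if "u \<in> ideal_times M I L" "v \<in> ideal_times M I L" for u v
    using subgroup.m_closed[OF W that] by simp
  have Wdiff: "u \<ominus>\<^bsub>M\<^esub> v \<in> ideal_times M I L" if "u \<in> ideal_times M I L" "v \<in> ideal_times M I L" for u v
    using Wadd[OF that(1)] subgroup.m_inv_closed[OF W that(2)] by (simp add: a_minus_def a_inv_def)
  define g where "g = (\<lambda>n. SOME y. y \<in> carrier M \<and> f y = n)"
  have g: "g n \<in> carrier M" "f (g n) = n" if "n \<in> carrier N" for n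
  proof -
    have "\<exists>y. y \<in> carrier M \<and> f y = n" using that unfolding surj[symmetric] by (elim imageE) auto
    from someI_ex[OF this] show "g n \<in> carrier M" "f (g n) = n" by (simp_all add: g_def)
  qed
  \<comment> \<open>Two preimages of the same element differ by an element of the kernel.\<close>
  have diffL: "a \<odot>\<^bsub>M\<^esub> y \<ominus>\<^bsub>M\<^esub> a \<odot>\<^bsub>M\<^esub> z \<in> ideal_times M I L"
    if "a \<in> I" "y \<in> carrier M" "z \<in> carrier M" "f y = f z" for a y z
  proof -
    have "y \<ominus>\<^bsub>M\<^esub> z \<in> L"
      using that lin_hom_diff[OF M modN f that(2,3)] fc by (simp add: L_def a_minus_def N.r_neg)
    moreover have "a \<odot>\<^bsub>M\<^esub> (y \<ominus>\<^bsub>M\<^esub> z) = a \<odot>\<^bsub>M\<^esub> y \<ominus>\<^bsub>M\<^esub> a \<odot>\<^bsub>M\<^esub> z"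
      using that IA by (simp add: a_minus_def M.smult_r_distr M.smult_r_minus)
    ultimately show ?thesis using ideal_times_incl[OF that(1)] by metis
  qed
  obtain E where E: "E \<in> hom (free_Abelian_group (I \<times> carrier M)) (add_monoid M)"
    and Eu: "\<And>a y. a \<in> I \<Longrightarrow> y \<in> carrier M \<Longrightarrow> E (frag_of (a, y)) = a \<odot>\<^bsub>M\<^esub> y"
    by (rule tensor_eval[OF M.M.abelian_group_axioms, of I "carrier M" "\<lambda>a y. a \<odot>\<^bsub>M\<^esub> y"])
      (use IA in auto)
  obtain EN where EN: "EN \<in> hom (free_Abelian_group (I \<times> carrier N)) (add_monoid N)"
    and ENu: "\<And>a y. a \<in> I \<Longrightarrow> y \<in> carrier N \<Longrightarrow> EN (frag_of (a, y)) = a \<odot>\<^bsub>N\<^esub> y"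
    by (rule tensor_eval[OF N.M.abelian_group_axioms, of I "carrier N" "\<lambda>a y. a \<odot>\<^bsub>N\<^esub> y"])
      (use IA in auto)
  obtain EG where EG: "EG \<in> hom (free_Abelian_group (I \<times> carrier N)) (add_monoid M)"
    and EGu: "\<And>a y. a \<in> I \<Longrightarrow> y \<in> carrier N \<Longrightarrow> EG (frag_of (a, y)) = a \<odot>\<^bsub>M\<^esub> g y"
    by (rule tensor_eval[OF M.M.abelian_group_axioms, of I "carrier N" "\<lambda>a y. a \<odot>\<^bsub>M\<^esub> g y"])
      (use IA g in auto)
  note E_simps = free_hom_frag[OF M.M.abelian_group_axioms E]
  note EN_simps = free_hom_frag[OF N.M.abelian_group_axioms EN]
  note EG_simps = free_hom_frag[OF M.M.abelian_group_axioms EG]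
  define push :: "('a \<times> 'b \<Rightarrow>\<^sub>0 int) \<Rightarrow> ('a \<times> 'c \<Rightarrow>\<^sub>0 int)"
    where "push = frag_extend (\<lambda>(a, y). frag_of (a, f y))"
  have keys_push: "Poly_Mapping.keys (push p) \<subseteq> I \<times> carrier N"
    if "Poly_Mapping.keys p \<subseteq> I \<times> carrier M" for p :: "'a \<times> 'b \<Rightarrow>\<^sub>0 int"
    unfolding push_def
  proof (intro subset_trans[OF keys_frag_extend] UN_least)
    fix z assume "z \<in> Poly_Mapping.keys p"
    then have "z \<in> I \<times> carrier M" using that by blast
    then show "Poly_Mapping.keys (case z of (a, y) \<Rightarrow> frag_of (a, f y)) \<subseteq> I \<times> carrier N"
      using fc by (cases z) simp
  qed
  obtain p where p: "Poly_Mapping.keys p \<subseteq> I \<times> carrier M" "E p = x"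
    using ideal_times_repr[OF M _ E Eu x] I.a_subset by auto
  have ENp: "EN (push q) = f (E q)" if "Poly_Mapping.keys q \<subseteq> I \<times> carrier M" for q
  proof (rule free_Abelian_group_induct[OF that])
    show "EN (push 0) = f (E 0)"
      using lin_hom_zero[OF M modN f] by (simp add: push_def EN_simps E_simps)
  next
    fix u v :: "'a \<times> 'b \<Rightarrow>\<^sub>0 int"
    assume "Poly_Mapping.keys u \<subseteq> I \<times> carrier M" "Poly_Mapping.keys v \<subseteq> I \<times> carrier M"
      "EN (push u) = f (E u)" "EN (push v) = f (E v)"
    then show "EN (push (u - v)) = f (E (u - v))"
      using EN_simps(3)[OF keys_push keys_push, of u v] lin_hom_diff[OF M modN f]
      by (simp add: push_def frag_extend_diff E_simps)
  next
    fix z assume "z \<in> I \<times> carrier M"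
    then show "EN (push (frag_of z)) = f (E (frag_of z))"
      using f fc IA by (auto simp: push_def Eu ENu lin_hom_def)
  qed
  have "push p \<in> tensor_null A (ideal_module A I) N"
    by (rule flat_relation[OF N I _ EN ENu])
      (use keys_push[OF p(1)] ENp[OF p(1)] p(2) fx in \<open>simp_all add: tensor_free_def\<close>)
  \<comment> \<open>Replacing elements of \<open>N\<close> by their chosen preimages is bilinear only up to \<open>I L\<close>.\<close>
  have push_W: "EG (push p) \<in> ideal_times M I L"
  proof (rule tensor_null_eval[where u = "\<lambda>a n. a \<odot>\<^bsub>M\<^esub> g n" and M = "ideal_module A I"
        and N = N and A = A and L = M and p = "push p"])
    show "Module.module A (ideal_module A I)"
      using module_ideal_module[OF M.R.is_cring I] .
    show "Module.module A N" by (rule modN)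
    show "abelian_group M" by (rule M.M.abelian_group_axioms)
    show "EG \<in> hom (free_Abelian_group (carrier (ideal_module A I) \<times> carrier N)) (add_monoid M)"
      using EG by simp
    show "subgroup (ideal_times M I L) (add_monoid M)" by (rule W)
    show "push p \<in> tensor_null A (ideal_module A I) N" by fact
  next
    fix a n assume "a \<in> carrier (ideal_module A I)" "n \<in> carrier N"
    then show "EG (frag_of (a, n)) = a \<odot>\<^bsub>M\<^esub> g n" using EGu by simp
  next
    fix a a' n assume "a \<in> carrier (ideal_module A I)" "a' \<in> carrier (ideal_module A I)" "n \<in> carrier N"
    then have "(a \<oplus>\<^bsub>A\<^esub> a') \<odot>\<^bsub>M\<^esub> g n \<ominus>\<^bsub>M\<^esub> a \<odot>\<^bsub>M\<^esub> g n \<ominus>\<^bsub>M\<^esub> a' \<odot>\<^bsub>M\<^esub> g n = \<zero>\<^bsub>M\<^esub>"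
      using IA g by (simp add: M.smult_l_distr a_minus_def M.a_ac M.r_neg M.r_neg1 M.r_neg2)
    then show "(a \<oplus>\<^bsub>ideal_module A I\<^esub> a') \<odot>\<^bsub>M\<^esub> g n \<ominus>\<^bsub>M\<^esub> a \<odot>\<^bsub>M\<^esub> g n \<ominus>\<^bsub>M\<^esub> a' \<odot>\<^bsub>M\<^esub> g n
        \<in> ideal_times M I L" using Wz by simp
  next
    fix a n n' assume *: "a \<in> carrier (ideal_module A I)" "n \<in> carrier N" "n' \<in> carrier N"
    have "a \<odot>\<^bsub>M\<^esub> g (n \<oplus>\<^bsub>N\<^esub> n') \<ominus>\<^bsub>M\<^esub> a \<odot>\<^bsub>M\<^esub> (g n \<oplus>\<^bsub>M\<^esub> g n') \<in> ideal_times M I L"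
      using * g f by (intro diffL) (auto simp: lin_hom_def)
    moreover have "a \<odot>\<^bsub>M\<^esub> g (n \<oplus>\<^bsub>N\<^esub> n') \<ominus>\<^bsub>M\<^esub> a \<odot>\<^bsub>M\<^esub> (g n \<oplus>\<^bsub>M\<^esub> g n') =
        a \<odot>\<^bsub>M\<^esub> g (n \<oplus>\<^bsub>N\<^esub> n') \<ominus>\<^bsub>M\<^esub> a \<odot>\<^bsub>M\<^esub> g n \<ominus>\<^bsub>M\<^esub> a \<odot>\<^bsub>M\<^esub> g n'"
      using * IA g by (simp add: M.smult_r_distr a_minus_def M.minus_add M.a_assoc)
    ultimately show "a \<odot>\<^bsub>M\<^esub> g (n \<oplus>\<^bsub>N\<^esub> n') \<ominus>\<^bsub>M\<^esub> a \<odot>\<^bsub>M\<^esub> g n \<ominus>\<^bsub>M\<^esub> a \<odot>\<^bsub>M\<^esub> g n'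
        \<in> ideal_times M I L" by simp
  next
    fix b a n assume *: "b \<in> carrier A" "a \<in> carrier (ideal_module A I)" "n \<in> carrier N"
    have "a \<odot>\<^bsub>M\<^esub> (b \<odot>\<^bsub>M\<^esub> g n) \<ominus>\<^bsub>M\<^esub> a \<odot>\<^bsub>M\<^esub> g (b \<odot>\<^bsub>N\<^esub> n) \<in> ideal_times M I L"
      using * g f by (intro diffL) (auto simp: lin_hom_def)
    moreover have "(b \<otimes>\<^bsub>A\<^esub> a) \<odot>\<^bsub>M\<^esub> g n = a \<odot>\<^bsub>M\<^esub> (b \<odot>\<^bsub>M\<^esub> g n)"
      using * IA g M.R.m_comm[of b a] by (simp add: M.smult_assoc1)
    ultimately show "(b \<odot>\<^bsub>ideal_module A I\<^esub> a) \<odot>\<^bsub>M\<^esub> g n \<ominus>\<^bsub>M\<^esub> a \<odot>\<^bsub>M\<^esub> g (b \<odot>\<^bsub>N\<^esub> n)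
        \<in> ideal_times M I L" by simp
  qed
  have diff: "E q \<ominus>\<^bsub>M\<^esub> EG (push q) \<in> ideal_times M I L"
    if "Poly_Mapping.keys q \<subseteq> I \<times> carrier M" for q
  proof (rule free_Abelian_group_induct[OF that])
    show "E 0 \<ominus>\<^bsub>M\<^esub> EG (push 0) \<in> ideal_times M I L"
      using Wdiff[OF Wz Wz] by (simp add: push_def EG_simps E_simps)
  next
    fix u v :: "'a \<times> 'b \<Rightarrow>\<^sub>0 int"
    assume uv: "Poly_Mapping.keys u \<subseteq> I \<times> carrier M" "Poly_Mapping.keys v \<subseteq> I \<times> carrier M"
      "E u \<ominus>\<^bsub>M\<^esub> EG (push u) \<in> ideal_times M I L" "E v \<ominus>\<^bsub>M\<^esub> EG (push v) \<in> ideal_times M I L"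
    have c: "E u \<in> carrier M" "E v \<in> carrier M" "EG (push u) \<in> carrier M" "EG (push v) \<in> carrier M"
      using uv(1,2) keys_push E_simps(2) EG_simps(2) by auto
    have "E (u - v) \<ominus>\<^bsub>M\<^esub> EG (push (u - v)) =
        (E u \<ominus>\<^bsub>M\<^esub> E v) \<ominus>\<^bsub>M\<^esub> (EG (push u) \<ominus>\<^bsub>M\<^esub> EG (push v))"
      using EG_simps(3)[OF keys_push[OF uv(1)] keys_push[OF uv(2)]] uv(1,2)
      by (simp add: push_def frag_extend_diff E_simps)
    also have "\<dots> = (E u \<ominus>\<^bsub>M\<^esub> EG (push u)) \<ominus>\<^bsub>M\<^esub> (E v \<ominus>\<^bsub>M\<^esub> EG (push v))"
      using c by (simp add: a_minus_def M.minus_add M.a_ac)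
    finally show "E (u - v) \<ominus>\<^bsub>M\<^esub> EG (push (u - v)) \<in> ideal_times M I L"
      using Wdiff[OF uv(3,4)] by simp
  next
    fix z assume "z \<in> I \<times> carrier M"
    then obtain a y where "z = (a, y)" "a \<in> I" "y \<in> carrier M" by auto
    then show "E (frag_of z) \<ominus>\<^bsub>M\<^esub> EG (push (frag_of z)) \<in> ideal_times M I L"
      using diffL[of a y "g (f y)"] g[OF fc] fc by (simp add: push_def Eu EGu)
  qed
  have c: "E p \<in> carrier M" "EG (push p) \<in> carrier M"
    using p(1) keys_push E_simps(2) EG_simps(2) by auto
  then have "(E p \<ominus>\<^bsub>M\<^esub> EG (push p)) \<oplus>\<^bsub>M\<^esub> EG (push p) = x"
    using p(2) by (simp add: a_minus_def M.a_assoc M.l_neg)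
  then show ?thesis
    using Wadd[OF diff[OF p(1)] push_W] by (simp add: L_def)
qed

section \<open>Reduction modulo the maximal ideal\<close>

locale artin_algebra = K: field K for K :: "'k ring" +
  fixes A :: "('k, 'a) module"
  assumes Art: "A \<in> Art K"
begin

sublocale A: algebra K A
  using Art by (simp add: Art_def)

abbreviation (input) \<mm> where "\<mm> \<equiv> max_ideal A"

lemma maximalideal_max_ideal: "maximalideal I A \<longleftrightarrow> I = \<mm>"
proof -
  have ex1: "\<exists>!I. maximalideal I A" using Art by (simp add: Art_def)
  show ?thesis
    unfolding max_ideal_def using theI'[OF ex1] the1_equality[OF ex1] by blast
qed

sublocale A: local_artinian A \<mm>
proof (rule local_artinian.intro[OF A.M_cring], rule local_artinian_axioms.intro)
  show "artinian A" using Art by (simp add: Art_def)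
qed (simp_all add: maximalideal_max_ideal)

abbreviation (input) \<iota> where "\<iota> c \<equiv> c \<odot>\<^bsub>A\<^esub> \<one>\<^bsub>A\<^esub>"

lemma augment_ex1:
  assumes "a \<in> carrier A"
  shows "\<exists>!c. c \<in> carrier K \<and> \<mm> +>\<^bsub>A\<^esub> \<iota> c = \<mm> +>\<^bsub>A\<^esub> a"
proof -
  have bij: "bij_betw (\<lambda>c. \<mm> +>\<^bsub>A\<^esub> \<iota> c) (carrier K) (carrier (A Quot \<mm>))"
    using Art by (simp add: Art_def ring_iso_def)
  have "\<mm> +>\<^bsub>A\<^esub> a \<in> carrier (A Quot \<mm>)"
    using assms by (auto simp: FactRing_simps)
  then obtain c where "c \<in> carrier K" "\<mm> +>\<^bsub>A\<^esub> a = \<mm> +>\<^bsub>A\<^esub> \<iota> c"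
    unfolding bij_betw_imp_surj_on[OF bij, symmetric] by blast
  then show ?thesis
    using bij_betw_imp_inj_on[OF bij] by (intro ex1I[of _ c]) (auto dest: inj_onD)
qed

text \<open>The augmentation of \<open>a\<close> is characterised by \<open>a - c \<cdot> 1 \<in> \<mm>\<close>; from this it is seen to be a
  homomorphism of rings, so that the residue field is an \<open>A\<close>-module.\<close>

lemma augment_eqI:
  assumes "a \<in> carrier A" and "c \<in> carrier K" and "a \<ominus>\<^bsub>A\<^esub> \<iota> c \<in> \<mm>"
  shows "augment K A a = c"
  unfolding augment_def
  using A.quotient_eq_iff_same_a_r_cos[OF A.mx.is_ideal, of a "\<iota> c"] assms
  by (intro the1_equality[OF augment_ex1]) auto

lemma augment_closed: "a \<in> carrier A \<Longrightarrow> augment K A a \<in> carrier K"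
  unfolding augment_def using theI'[OF augment_ex1] by blast

lemma augment_diff: "a \<in> carrier A \<Longrightarrow> a \<ominus>\<^bsub>A\<^esub> \<iota> (augment K A a) \<in> \<mm>"
  using A.quotient_eq_iff_same_a_r_cos[OF A.mx.is_ideal, of a "\<iota> (augment K A a)"]
    theI'[OF augment_ex1, of a]
  by (auto simp: augment_def)

lemma zero_in_m: "\<zero>\<^bsub>A\<^esub> \<in> \<mm>"
  by (rule A.mx.zero_closed)

lemma augment_unit: "c \<in> carrier K \<Longrightarrow> augment K A (\<iota> c) = c"
  using zero_in_m by (intro augment_eqI) (auto simp: a_minus_def A.M.r_neg)

lemma augment_one: "augment K A \<one>\<^bsub>A\<^esub> = \<one>\<^bsub>K\<^esub>"
  using augment_unit[of "\<one>\<^bsub>K\<^esub>"] by simp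

lemma augment_add:
  assumes "a \<in> carrier A" and "b \<in> carrier A"
  shows "augment K A (a \<oplus>\<^bsub>A\<^esub> b) = augment K A a \<oplus>\<^bsub>K\<^esub> augment K A b"
proof (rule augment_eqI)
  let ?c = "augment K A a" and ?d = "augment K A b"
  note c = augment_closed[OF assms(1)] augment_closed[OF assms(2)]
  have "(a \<oplus>\<^bsub>A\<^esub> b) \<ominus>\<^bsub>A\<^esub> \<iota> (?c \<oplus>\<^bsub>K\<^esub> ?d) = (a \<ominus>\<^bsub>A\<^esub> \<iota> ?c) \<oplus>\<^bsub>A\<^esub> (b \<ominus>\<^bsub>A\<^esub> \<iota> ?d)"
    using c assms by (simp add: A.smult_l_distr a_minus_def A.M.minus_add A.M.a_ac)
  then show "(a \<oplus>\<^bsub>A\<^esub> b) \<ominus>\<^bsub>A\<^esub> \<iota> (?c \<oplus>\<^bsub>K\<^esub> ?d) \<in> \<mm>"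
    using augment_diff assms A.mx.a_closed by metis
qed (use assms augment_closed in auto)

lemma augment_mult:
  assumes "a \<in> carrier A" and "b \<in> carrier A"
  shows "augment K A (a \<otimes>\<^bsub>A\<^esub> b) = augment K A a \<otimes>\<^bsub>K\<^esub> augment K A b"
proof (rule augment_eqI)
  let ?c = "augment K A a" and ?d = "augment K A b"
  note c = augment_closed[OF assms(1)] augment_closed[OF assms(2)]
  have "\<iota> (?c \<otimes>\<^bsub>K\<^esub> ?d) = \<iota> ?c \<otimes>\<^bsub>A\<^esub> \<iota> ?d"
    using c by (simp add: A.smult_assoc1 A.smult_assoc2)
  moreover have "a \<otimes>\<^bsub>A\<^esub> b \<ominus>\<^bsub>A\<^esub> x \<otimes>\<^bsub>A\<^esub> y = (a \<ominus>\<^bsub>A\<^esub> x) \<otimes>\<^bsub>A\<^esub> b \<oplus>\<^bsub>A\<^esub> x \<otimes>\<^bsub>A\<^esub> (b \<ominus>\<^bsub>A\<^esub> y)"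
    if "x \<in> carrier A" "y \<in> carrier A" for x y
    using assms that by algebra
  ultimately have "a \<otimes>\<^bsub>A\<^esub> b \<ominus>\<^bsub>A\<^esub> \<iota> (?c \<otimes>\<^bsub>K\<^esub> ?d) =
      (a \<ominus>\<^bsub>A\<^esub> \<iota> ?c) \<otimes>\<^bsub>A\<^esub> b \<oplus>\<^bsub>A\<^esub> \<iota> ?c \<otimes>\<^bsub>A\<^esub> (b \<ominus>\<^bsub>A\<^esub> \<iota> ?d)"
    using c by simp
  then show "a \<otimes>\<^bsub>A\<^esub> b \<ominus>\<^bsub>A\<^esub> \<iota> (?c \<otimes>\<^bsub>K\<^esub> ?d) \<in> \<mm>"
    using augment_diff assms c A.mx.I_l_closed A.mx.I_r_closed
    by (simp add: A.mx.a_closed)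
qed (use assms augment_closed in auto)

lemma residue_alg_simps [simp]:
  "carrier (residue_alg K A) = carrier K"
  "add (residue_alg K A) = add K"
  "ring.zero (residue_alg K A) = ring.zero K"
  "smult (residue_alg K A) = (\<lambda>a c. augment K A a \<otimes>\<^bsub>K\<^esub> c)"
  by (simp_all add: residue_alg_def via_augment_def with_smult_def)

lemma module_residue_alg: "Module.module A (residue_alg K A)"
proof -
  have "abelian_group (residue_alg K A)"
  proof (rule abelian_groupI)
    show "\<exists>y\<in>carrier (residue_alg K A). y \<oplus>\<^bsub>residue_alg K A\<^esub> x = \<zero>\<^bsub>residue_alg K A\<^esub>"
      if "x \<in> carrier (residue_alg K A)" for x
      using that K.l_neg[of x] K.a_inv_closed[of x] by auto
  qed (use K.a_assoc K.a_comm in auto)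
  then show ?thesis
    by (rule moduleI[OF A.M_cring])
      (auto simp: augment_closed augment_add augment_mult augment_one K.l_distr K.r_distr K.m_assoc)
qed

end

text \<open>The condition that a deformation imposes at one object: \<open>\<phi>\<close> exhibits \<open>S\<close> as \<open>M \<otimes>\<^sub>A K\<close>, with \<open>M\<close> flat.
  Being a statement about single algebras, it is inherited by pullbacks of deformations.\<close>

definition (in artin_algebra) is_reduction ::
  "('a, 'c) module \<Rightarrow> ('k, 's) module \<Rightarrow> ('c \<Rightarrow> 's) \<Rightarrow> bool" where
  "is_reduction M S \<phi> \<longleftrightarrow> algebra A M \<and> algebra K S \<and> flat A M \<and> \<phi> \<in> alg_hom A M (via_augment K A S) \<and>
     (\<exists>h \<in> alg_iso K (base_change K A M) S. \<forall>s \<in> carrier M. \<forall>c \<in> carrier K.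
        h (pure_tensor A M (residue_alg K A) s c) = c \<odot>\<^bsub>S\<^esub> \<phi> s)"

lemma via_augment_simps [simp]:
  "carrier (via_augment K A S) = carrier S"
  "monoid.mult (via_augment K A S) = monoid.mult S"
  "one (via_augment K A S) = one S"
  "add (via_augment K A S) = add S"
  "smult (via_augment K A S) = (\<lambda>a s. augment K A a \<odot>\<^bsub>S\<^esub> s)"
  by (simp_all add: via_augment_def with_smult_def)

lemma (in artin_algebra) is_reductionD:
  assumes "is_reduction M S \<phi>"
  shows "algebra A M" "algebra K S" "flat A M" "Module.module A M"
    and "s \<in> carrier M \<Longrightarrow> \<phi> s \<in> carrier S"
    and "s \<in> carrier M \<Longrightarrow> t \<in> carrier M \<Longrightarrow> \<phi> (s \<oplus>\<^bsub>M\<^esub> t) = \<phi> s \<oplus>\<^bsub>S\<^esub> \<phi> t"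
    and "a \<in> carrier A \<Longrightarrow> s \<in> carrier M \<Longrightarrow> \<phi> (a \<odot>\<^bsub>M\<^esub> s) = augment K A a \<odot>\<^bsub>S\<^esub> \<phi> s"
    and "\<phi> \<zero>\<^bsub>M\<^esub> = \<zero>\<^bsub>S\<^esub>"
    and "s \<in> carrier M \<Longrightarrow> t \<in> carrier M \<Longrightarrow> \<phi> (s \<ominus>\<^bsub>M\<^esub> t) = \<phi> s \<ominus>\<^bsub>S\<^esub> \<phi> t"
proof -
  show M: "algebra A M" and S: "algebra K S" and "flat A M" and "Module.module A M"
    using assms by (auto simp: is_reduction_def flat_def)
  interpret M: algebra A M by fact
  interpret S: algebra K S by fact
  show c: "\<phi> s \<in> carrier S" if "s \<in> carrier M" for s
    using assms that by (auto simp: is_reduction_def alg_hom_def ring_hom_def)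
  show add: "\<phi> (s \<oplus>\<^bsub>M\<^esub> t) = \<phi> s \<oplus>\<^bsub>S\<^esub> \<phi> t" if "s \<in> carrier M" "t \<in> carrier M" for s t
    using assms that by (auto simp: is_reduction_def alg_hom_def ring_hom_def)
  show "\<phi> (a \<odot>\<^bsub>M\<^esub> s) = augment K A a \<odot>\<^bsub>S\<^esub> \<phi> s" if "a \<in> carrier A" "s \<in> carrier M" for a s
    using assms that by (auto simp: is_reduction_def alg_hom_def)
  have h: "group_hom (add_monoid M) (add_monoid S) \<phi>"
    using c add M.M.a_group S.M.a_group
    by (auto simp: group_hom_def group_hom_axioms_def hom_def)
  show "\<phi> \<zero>\<^bsub>M\<^esub> = \<zero>\<^bsub>S\<^esub>" using group_hom.hom_one[OF h] by simp
  show "\<phi> (s \<ominus>\<^bsub>M\<^esub> t) = \<phi> s \<ominus>\<^bsub>S\<^esub> \<phi> t" if "s \<in> carrier M" "t \<in> carrier M" for s t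
    using group_hom.hom_inv[OF h, of t] add[of s "\<ominus>\<^bsub>M\<^esub> t"] that by (simp add: a_minus_def a_inv_def)
qed

text \<open>The isomorphism \<open>M \<otimes>\<^sub>A K \<cong> S\<close> read on formal sums: evaluation \<open>\<Sum> s\<^sub>i \<otimes> c\<^sub>i \<mapsto> \<Sum> c\<^sub>i \<phi>(s\<^sub>i)\<close> is onto
  \<open>S\<close>, and only the formal sums that vanish in the tensor product are mapped to \<open>0\<close>.\<close>

lemma (in artin_algebra) reduction_hom:
  assumes red: "is_reduction M S \<phi>"
  obtains E where "E \<in> hom (free_Abelian_group (carrier M \<times> carrier K)) (add_monoid S)"
    and "\<And>s c. s \<in> carrier M \<Longrightarrow> c \<in> carrier K \<Longrightarrow> E (frag_of (s, c)) = c \<odot>\<^bsub>S\<^esub> \<phi> s"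
    and "carrier S = E ` {p. Poly_Mapping.keys p \<subseteq> carrier M \<times> carrier K}"
    and "\<And>p. Poly_Mapping.keys p \<subseteq> carrier M \<times> carrier K \<Longrightarrow> E p = \<zero>\<^bsub>S\<^esub> \<Longrightarrow>
      p \<in> tensor_null A M (residue_alg K A)"
proof -
  let ?k = "residue_alg K A"
  let ?F = "free_Abelian_group (carrier M \<times> carrier K)"
  note D = is_reductionD[OF red]
  interpret M: algebra A M by (rule D)
  interpret S: algebra K S by (rule D)
  have F: "tensor_free M ?k = ?F" by (simp add: tensor_free_def)
  obtain h where h: "h \<in> alg_iso K (base_change K A M) S"
    and hp: "\<And>s c. s \<in> carrier M \<Longrightarrow> c \<in> carrier K \<Longrightarrow> h (pure_tensor A M ?k s c) = c \<odot>\<^bsub>S\<^esub> \<phi> s"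
    using red by (auto simp: is_reduction_def)
  have carr: "carrier (base_change K A M) = tensor_coset A M ?k ` carrier ?F"
    by (simp add: base_change_def with_smult_def tensor_def F)
  define E where "E = (\<lambda>p. h (tensor_coset A M ?k p))"
  have "comm_group ?F" by (rule abelian_free_Abelian_group)
  have normal: "tensor_null A M ?k \<lhd> ?F"
    using comm_group.normal_iff_subgroup[OF \<open>comm_group ?F\<close>]
      tensor_null_subgroup[OF D(4) module_residue_alg] F by simp
  have hadd: "h (U \<oplus>\<^bsub>base_change K A M\<^esub> V) = h U \<oplus>\<^bsub>S\<^esub> h V"
    if "U \<in> carrier (base_change K A M)" "V \<in> carrier (base_change K A M)" for U V
    using h that by (auto simp: alg_iso_def alg_hom_def ring_hom_def)
  have bij: "bij_betw h (carrier (base_change K A M)) (carrier S)"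
    using h by (simp add: alg_iso_def)
  have E: "E \<in> hom ?F (add_monoid S)"
  proof (rule homI)
    fix p assume "p \<in> carrier ?F"
    then show "E p \<in> carrier (add_monoid S)"
      using bij_betwE[OF bij] carr by (simp add: E_def)
  next
    fix p q assume pq: "p \<in> carrier ?F" "q \<in> carrier ?F"
    have "tensor_coset A M ?k (p \<otimes>\<^bsub>?F\<^esub> q) =
        tensor_coset A M ?k p \<oplus>\<^bsub>base_change K A M\<^esub> tensor_coset A M ?k q"
      using normal.rcos_sum[OF normal pq]
      by (simp add: base_change_def with_smult_def tensor_def F tensor_coset_def)
    then show "E (p \<otimes>\<^bsub>?F\<^esub> q) = E p \<otimes>\<^bsub>add_monoid S\<^esub> E q"
      using hadd pq carr by (simp add: E_def)
  qed
  have E0: "E 0 = \<zero>\<^bsub>S\<^esub>" by (rule free_hom_frag(1)[OF S.M.abelian_group_axioms E])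
  show thesis
  proof (rule that[OF E])
    show "E (frag_of (s, c)) = c \<odot>\<^bsub>S\<^esub> \<phi> s" if "s \<in> carrier M" "c \<in> carrier K" for s c
      using hp[OF that] by (simp add: E_def pure_tensor_def)
    show "carrier S = E ` {p. Poly_Mapping.keys p \<subseteq> carrier M \<times> carrier K}"
    proof -
      have "carrier S = h ` carrier (base_change K A M)" using bij by (simp add: bij_betw_def)
      also have "\<dots> = E ` carrier ?F" by (simp add: carr E_def image_image)
      also have "carrier ?F = {p. Poly_Mapping.keys p \<subseteq> carrier M \<times> carrier K}" by auto
      finally show ?thesis .
    qed
  next
    fix p assume p: "Poly_Mapping.keys p \<subseteq> carrier M \<times> carrier K" "E p = \<zero>\<^bsub>S\<^esub>"
    then have pc: "p \<in> carrier (tensor_free M ?k)" "0 \<in> carrier (tensor_free M ?k)" by (simp_all add: F)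
    have "tensor_coset A M ?k p = tensor_coset A M ?k 0"
      by (rule inj_onD[OF bij_betw_imp_inj_on[OF bij]]) (use p E0 pc in \<open>auto simp: E_def carr F\<close>)
    then show "p \<in> tensor_null A M ?k"
      using tensor_coset_eq_iff[OF D(4) module_residue_alg pc] by simp
  qed
qed

text \<open>Every \<open>\<Sum> c\<^sub>i \<phi>(s\<^sub>i)\<close> is itself a value of \<open>\<phi>\<close>, because the scalar \<open>c\<^sub>i\<close> lifts to \<open>c\<^sub>i \<cdot> 1\<close> in \<open>A\<close>.\<close>

lemma (in artin_algebra) reduction_surj:
  assumes red: "is_reduction M S \<phi>" and t: "t \<in> carrier S"
  shows "\<exists>s\<in>carrier M. \<phi> s = t"
proof -
  note D = is_reductionD[OF red]
  interpret M: algebra A M by (rule D)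
  interpret S: algebra K S by (rule D)
  obtain E where E: "E \<in> hom (free_Abelian_group (carrier M \<times> carrier K)) (add_monoid S)"
    and Eu: "\<And>s c. s \<in> carrier M \<Longrightarrow> c \<in> carrier K \<Longrightarrow> E (frag_of (s, c)) = c \<odot>\<^bsub>S\<^esub> \<phi> s"
    and surj: "carrier S = E ` {p. Poly_Mapping.keys p \<subseteq> carrier M \<times> carrier K}"
    by (rule reduction_hom[OF red]) blast
  note E_simps = free_hom_frag[OF S.M.abelian_group_axioms E]
  have lift: "\<exists>s\<in>carrier M. \<phi> s = E p" if "Poly_Mapping.keys p \<subseteq> carrier M \<times> carrier K" for p
  proof (rule free_Abelian_group_induct[OF that])
    show "\<exists>s\<in>carrier M. \<phi> s = E 0"
      using D(8) E_simps(1) by (intro bexI[of _ "\<zero>\<^bsub>M\<^esub>"]) auto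
  next
    fix p q :: "'b \<times> 'k \<Rightarrow>\<^sub>0 int"
    assume pq: "Poly_Mapping.keys p \<subseteq> carrier M \<times> carrier K" "Poly_Mapping.keys q \<subseteq> carrier M \<times> carrier K"
      "\<exists>s\<in>carrier M. \<phi> s = E p" "\<exists>s\<in>carrier M. \<phi> s = E q"
    then obtain u v where "u \<in> carrier M" "\<phi> u = E p" "v \<in> carrier M" "\<phi> v = E q" by blast
    then show "\<exists>s\<in>carrier M. \<phi> s = E (p - q)"
      using D(9)[of u v] E_simps(3)[OF pq(1,2)] by (intro bexI[of _ "u \<ominus>\<^bsub>M\<^esub> v"]) auto
  next
    fix z assume "z \<in> carrier M \<times> carrier K"
    then obtain s c where z: "z = (s, c)" "s \<in> carrier M" "c \<in> carrier K" by auto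
    then show "\<exists>s\<in>carrier M. \<phi> s = E (frag_of z)"
      using D(7)[of "\<iota> c" s] by (intro bexI[of _ "\<iota> c \<odot>\<^bsub>M\<^esub> s"]) (auto simp: Eu augment_unit)
  qed
  from t surj obtain p where "Poly_Mapping.keys p \<subseteq> carrier M \<times> carrier K" "t = E p" by blast
  with lift show ?thesis by metis
qed

text \<open>The kernel of \<open>\<phi>\<close> lies in \<open>\<mm> M\<close>. If \<open>\<phi>(s) = 0\<close> then \<open>s \<otimes> 1 = 0\<close>, and
  \<open>(x, c) \<mapsto> (c \<cdot> 1) x\<close> is bilinear over \<open>A\<close> modulo \<open>\<mm> M\<close>, so it maps \<open>s \<otimes> 1\<close> to an element of \<open>\<mm> M\<close>;
  this element is \<open>s\<close>.\<close>

lemma (in artin_algebra) reduction_kernel: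
  assumes red: "is_reduction M S \<phi>" and s: "s \<in> carrier M" "\<phi> s = \<zero>\<^bsub>S\<^esub>"
  shows "s \<in> ideal_times M \<mm> (carrier M)"
proof -
  let ?k = "residue_alg K A"
  let ?W = "ideal_times M \<mm> (carrier M)"
  note D = is_reductionD[OF red]
  interpret M: algebra A M by (rule D)
  interpret S: algebra K S by (rule D)
  obtain E where Eu: "\<And>s c. s \<in> carrier M \<Longrightarrow> c \<in> carrier K \<Longrightarrow> E (frag_of (s, c)) = c \<odot>\<^bsub>S\<^esub> \<phi> s"
    and ker: "\<And>p. Poly_Mapping.keys p \<subseteq> carrier M \<times> carrier K \<Longrightarrow> E p = \<zero>\<^bsub>S\<^esub> \<Longrightarrow>
      p \<in> tensor_null A M ?k"
    by (rule reduction_hom[OF red]) blast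
  have null: "frag_of (s, \<one>\<^bsub>K\<^esub>) \<in> tensor_null A M ?k"
    by (rule ker) (use s Eu in auto)
  have W: "subgroup ?W (add_monoid M)"
    by (rule ideal_times_subgroup[OF D(4)]) (use A.mx.a_subset in auto)
  have Wz: "\<zero>\<^bsub>M\<^esub> \<in> ?W" using subgroup.one_closed[OF W] by simp
  obtain G where G: "G \<in> hom (free_Abelian_group (carrier M \<times> carrier K)) (add_monoid M)"
    and Gu: "\<And>x c. x \<in> carrier M \<Longrightarrow> c \<in> carrier K \<Longrightarrow> G (frag_of (x, c)) = \<iota> c \<odot>\<^bsub>M\<^esub> x"
    by (rule tensor_eval[OF M.M.abelian_group_axioms, of "carrier M" "carrier K" "\<lambda>x c. \<iota> c \<odot>\<^bsub>M\<^esub> x"])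
      auto
  have "G (frag_of (s, \<one>\<^bsub>K\<^esub>)) \<in> ?W"
  proof (rule tensor_null_eval[where u = "\<lambda>x c. \<iota> c \<odot>\<^bsub>M\<^esub> x" and M = M
        and N = "?k" and A = A and L = M])
    show "Module.module A M" by (rule D)
    show "Module.module A ?k" by (rule module_residue_alg)
    show "abelian_group M" by (rule M.M.abelian_group_axioms)
    show "G \<in> hom (free_Abelian_group (carrier M \<times> carrier ?k)) (add_monoid M)" using G by simp
    show "subgroup ?W (add_monoid M)" by (rule W)
    show "frag_of (s, \<one>\<^bsub>K\<^esub>) \<in> tensor_null A M ?k" by (rule null)
  next
    fix x c assume "x \<in> carrier M" "c \<in> carrier ?k"
    then show "G (frag_of (x, c)) = \<iota> c \<odot>\<^bsub>M\<^esub> x" using Gu by simp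
  next
    fix x x' c assume "x \<in> carrier M" "x' \<in> carrier M" "c \<in> carrier ?k"
    then have "\<iota> c \<odot>\<^bsub>M\<^esub> (x \<oplus>\<^bsub>M\<^esub> x') \<ominus>\<^bsub>M\<^esub> \<iota> c \<odot>\<^bsub>M\<^esub> x \<ominus>\<^bsub>M\<^esub> \<iota> c \<odot>\<^bsub>M\<^esub> x' = \<zero>\<^bsub>M\<^esub>"
      by (simp add: M.smult_r_distr a_minus_def M.M.a_ac M.M.r_neg M.M.r_neg1 M.M.r_neg2)
    then show "\<iota> c \<odot>\<^bsub>M\<^esub> (x \<oplus>\<^bsub>M\<^esub> x') \<ominus>\<^bsub>M\<^esub> \<iota> c \<odot>\<^bsub>M\<^esub> x \<ominus>\<^bsub>M\<^esub> \<iota> c \<odot>\<^bsub>M\<^esub> x' \<in> ?W" using Wz by simp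
  next
    fix x c c' assume "x \<in> carrier M" "c \<in> carrier ?k" "c' \<in> carrier ?k"
    then have "\<iota> (c \<oplus>\<^bsub>K\<^esub> c') \<odot>\<^bsub>M\<^esub> x \<ominus>\<^bsub>M\<^esub> \<iota> c \<odot>\<^bsub>M\<^esub> x \<ominus>\<^bsub>M\<^esub> \<iota> c' \<odot>\<^bsub>M\<^esub> x = \<zero>\<^bsub>M\<^esub>"
      by (simp add: A.smult_l_distr M.smult_l_distr a_minus_def M.M.a_ac M.M.r_neg M.M.r_neg1 M.M.r_neg2)
    then show "\<iota> (c \<oplus>\<^bsub>?k\<^esub> c') \<odot>\<^bsub>M\<^esub> x \<ominus>\<^bsub>M\<^esub> \<iota> c \<odot>\<^bsub>M\<^esub> x \<ominus>\<^bsub>M\<^esub> \<iota> c' \<odot>\<^bsub>M\<^esub> x \<in> ?W"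
      using Wz by simp
  next
    fix a x c assume *: "a \<in> carrier A" "x \<in> carrier M" "c \<in> carrier ?k"
    let ?d = "augment K A a"
    have d: "?d \<in> carrier K" "c \<in> carrier K" using * augment_closed by auto
    \<comment> \<open>The scalar \<open>a\<close> acts on \<open>K\<close> through \<open>d\<close>, and \<open>a - d \<cdot> 1 \<in> \<mm>\<close>.\<close>
    have "(\<iota> c \<otimes>\<^bsub>A\<^esub> (a \<ominus>\<^bsub>A\<^esub> \<iota> ?d)) \<odot>\<^bsub>M\<^esub> x \<in> ?W"
      using * d augment_diff A.mx.I_l_closed by (intro ideal_times_incl) auto
    moreover have "(\<iota> c \<otimes>\<^bsub>A\<^esub> (a \<ominus>\<^bsub>A\<^esub> \<iota> ?d)) \<odot>\<^bsub>M\<^esub> x =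
        \<iota> c \<odot>\<^bsub>M\<^esub> (a \<odot>\<^bsub>M\<^esub> x) \<ominus>\<^bsub>M\<^esub> \<iota> c \<odot>\<^bsub>M\<^esub> (\<iota> ?d \<odot>\<^bsub>M\<^esub> x)"
      using * d by (simp add: M.smult_assoc1 a_minus_def M.smult_l_distr M.smult_r_distr
          M.smult_l_minus M.smult_r_minus)
    moreover have "\<iota> (?d \<otimes>\<^bsub>K\<^esub> c) = \<iota> c \<otimes>\<^bsub>A\<^esub> \<iota> ?d"
      using d K.m_comm[of ?d c] by (simp add: A.smult_assoc1 A.smult_assoc2)
    then have "\<iota> c \<odot>\<^bsub>M\<^esub> (\<iota> ?d \<odot>\<^bsub>M\<^esub> x) = \<iota> (?d \<otimes>\<^bsub>K\<^esub> c) \<odot>\<^bsub>M\<^esub> x"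
      using * d by (simp add: M.smult_assoc1)
    ultimately show "\<iota> c \<odot>\<^bsub>M\<^esub> (a \<odot>\<^bsub>M\<^esub> x) \<ominus>\<^bsub>M\<^esub> \<iota> (a \<odot>\<^bsub>?k\<^esub> c) \<odot>\<^bsub>M\<^esub> x \<in> ?W"
      by simp
  qed
  then show ?thesis
    using s Gu[of s "\<one>\<^bsub>K\<^esub>"] by simp
qed

text \<open>The algebraic heart of the matter: a homomorphism of flat \<open>A\<close>-algebras over the same reduction is an
  isomorphism. It is surjective by Nakayama's lemma, because \<open>N = f(M) + \<mm> N\<close>. Its kernel \<open>L\<close> is
  contained in the kernel of \<open>\<phi>\<close>, hence in \<open>\<mm> M\<close>, and \<open>L \<inter> \<mm> M = \<mm> L\<close> since \<open>N\<close> is flat; so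
  \<open>L = 0\<close> by Nakayama's lemma again.\<close>

lemma (in artin_algebra) iso_of_reduction:
  assumes M: "is_reduction M S \<phi>" and N: "is_reduction N S \<psi>"
    and f: "f \<in> alg_hom A M N" and comm: "\<And>s. s \<in> carrier M \<Longrightarrow> \<psi> (f s) = \<phi> s"
  shows "f \<in> alg_iso A M N"
proof -
  note DM = is_reductionD[OF M] and DN = is_reductionD[OF N]
  interpret M: algebra A M by (rule DM)
  interpret N: algebra A N by (rule DN)
  interpret S: algebra K S by (rule DM)
  have lin: "f \<in> lin_hom A M N"
    using f by (auto simp: alg_hom_def lin_hom_def ring_hom_def)
  have fc: "f x \<in> carrier N" if "x \<in> carrier M" for x using lin that by (auto simp: lin_hom_def)
  note hom = lin_hom_group_hom[OF DM(4) DN(4) lin]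
  have img: "submodule (f ` carrier M) A N"
  proof (rule submodule.intro)
    show "subgroup (f ` carrier M) (add_monoid N)"
      using group_hom.img_is_subgroup[OF hom] by simp
    show "submodule_axioms (f ` carrier M) A N"
    proof
      fix a v assume "a \<in> carrier A" "v \<in> f ` carrier M"
      then obtain x where x: "v = f x" "x \<in> carrier M" and a: "a \<in> carrier A" by blast
      then have "a \<odot>\<^bsub>N\<^esub> v = f (a \<odot>\<^bsub>M\<^esub> x)"
        using lin by (simp add: lin_hom_def)
      then show "a \<odot>\<^bsub>N\<^esub> v \<in> f ` carrier M"
        using M.smult_closed[OF a x(2)] by blast
    qed
  qed
  have "carrier N \<subseteq> f ` carrier M"
  proof (rule A.nakayama[OF DN(4) img order_refl])
    fix v assume v: "v \<in> carrier N"
    obtain x where x: "x \<in> carrier M" "\<phi> x = \<psi> v"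
      using reduction_surj[OF M DN(5)[OF v]] by blast
    have "v \<ominus>\<^bsub>N\<^esub> f x \<in> ideal_times N \<mm> (carrier N)"
    proof (rule reduction_kernel[OF N])
      show "\<psi> (v \<ominus>\<^bsub>N\<^esub> f x) = \<zero>\<^bsub>S\<^esub>"
        using DN(9)[OF v fc[OF x(1)]] comm x DN(5)[OF v] by (simp add: a_minus_def S.M.r_neg)
    qed (use v fc x in auto)
    moreover have "v = f x \<oplus>\<^bsub>N\<^esub> (v \<ominus>\<^bsub>N\<^esub> f x)"
      using v fc[OF x(1)] by (simp add: a_minus_def N.M.a_lcomm N.M.r_neg)
    ultimately show "\<exists>w\<in>f ` carrier M. \<exists>y\<in>ideal_times N \<mm> (carrier N). v = w \<oplus>\<^bsub>N\<^esub> y"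
      using x(1) by blast
  qed
  then have surj: "f ` carrier M = carrier N" using fc by blast
  define L where "L = {l \<in> carrier M. f l = \<zero>\<^bsub>N\<^esub>}"
  have "L \<subseteq> {\<zero>\<^bsub>M\<^esub>}"
  proof (rule A.nakayama[OF DM(4)])
    show "submodule {\<zero>\<^bsub>M\<^esub>} A M"
      by (rule submodule.intro) (auto intro!: submodule_axioms.intro M.M.add.triv_subgroup)
    show "L \<subseteq> carrier M" by (auto simp: L_def)
  next
    fix v assume v: "v \<in> L"
    then have vM: "v \<in> carrier M" "f v = \<zero>\<^bsub>N\<^esub>" by (auto simp: L_def)
    have "\<phi> v = \<zero>\<^bsub>S\<^esub>" using comm[OF vM(1)] vM(2) DN(8) by simp
    then have "v \<in> ideal_times M \<mm> L"
      unfolding L_def using flat_kernel[OF DM(4) DN(3) lin surj A.mx.is_ideal] reduction_kernel[OF M vM(1)] vM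
      by blast
    then show "\<exists>w\<in>{\<zero>\<^bsub>M\<^esub>}. \<exists>y\<in>ideal_times M \<mm> L. v = w \<oplus>\<^bsub>M\<^esub> y"
      using M.M.l_zero[OF vM(1)] by (intro bexI[of _ "\<zero>\<^bsub>M\<^esub>"] bexI[of _ v]) auto
  qed
  then have "inj_on f (carrier M)"
  proof (intro inj_onI)
    fix x y assume *: "L \<subseteq> {\<zero>\<^bsub>M\<^esub>}" "x \<in> carrier M" "y \<in> carrier M" "f x = f y"
    then have "x \<ominus>\<^bsub>M\<^esub> y \<in> L"
      using lin_hom_diff[OF DM(4) DN(4) lin] fc by (simp add: L_def a_minus_def N.M.r_neg)
    with * have "x \<ominus>\<^bsub>M\<^esub> y = \<zero>\<^bsub>M\<^esub>" by auto
    with * show "x = y" by (simp add: M.r_right_minus_eq)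
  qed
  with f surj show ?thesis
    by (simp add: alg_iso_def bij_betw_def)
qed

section \<open>Points, edges and triangles in the simplex category\<close>

definition point :: "'o \<Rightarrow> ('o, 'm) strng" where
  "point x = ([x], [])"

definition edge :: "('o, 'm) cat \<Rightarrow> 'm \<Rightarrow> ('o, 'm) strng" where
  "edge B f = ([Dom B f, Cod B f], [f])"

definition triangle :: "('o, 'm) cat \<Rightarrow> 'm \<Rightarrow> 'm \<Rightarrow> ('o, 'm) strng" where
  "triangle B f g = ([Dom B f, Cod B f, Cod B g], [f, g])"

text \<open>The arrow \<open>[z\<^sub>i] \<rightarrow> z\<close> of the simplex category that selects the \<open>i\<close>-th object of the string \<open>z\<close>.\<close>

definition vertex :: "('o, 'm) strng \<Rightarrow> nat \<Rightarrow> ('o, 'm) strng_arr" where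
  "vertex z i = (point (fst z ! i), \<lambda>_\<in>{..0}. i, z)"

text \<open>For \<open>i \<le> j\<close>, the arrow \<open>[z\<^sub>i \<rightarrow> z\<^sub>j] \<rightarrow> z\<close> that composes the arrows of \<open>z\<close> between the two positions; it
  is degenerate if \<open>i = j\<close>.\<close>

definition chord :: "('o, 'm) cat \<Rightarrow> ('o, 'm) strng \<Rightarrow> nat \<Rightarrow> nat \<Rightarrow> ('o, 'm) strng_arr" where
  "chord B z i j = (edge B (segment B z i j), \<lambda>l\<in>{..1}. if l = 0 then i else j, z)"

lemma dim_simps [simp]: "dim (point x) = 0" "dim (edge B f) = 1" "dim (triangle B f g) = 2"
  by (simp_all add: dim_def point_def edge_def triangle_def)

lemma fst_point [simp]: "fst (point x) ! 0 = x"
  by (simp add: point_def)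

lemma eps_obj_point [simp]: "eps_obj (point x) = x"
  by (simp add: eps_obj_def)

lemma segment_refl [simp]: "segment B y i i = Ide B (fst y ! i)"
  by (simp add: segment_def)

lemma segment_Suc: "i \<le> j \<Longrightarrow> segment B y i (Suc j) = Cmp B (snd y ! j) (segment B y i j)"
  by (simp add: segment_def)

lemma simplex_cat_simps [simp]:
  "x \<in> Obj (simplex_cat B k) \<longleftrightarrow> x \<in> strings B \<and> enat (dim x) \<le> k"
  "(x, f, y) \<in> Arr (simplex_cat B k) \<longleftrightarrow> x \<in> strings B \<and> enat (dim x) \<le> k \<and>
     y \<in> strings B \<and> enat (dim y) \<le> k \<and> f \<in> simplex_hom B x y"
  "Dom (simplex_cat B k) (x, f, y) = x"
  "Cod (simplex_cat B k) (x, f, y) = y"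
  "Ide (simplex_cat B k) x = (x, \<lambda>i\<in>{..dim x}. i, x)"
  "Cmp (simplex_cat B k) (y', g, z) (x, f, y) = (x, compose {..dim x} g f, z)"
  by (simp_all add: simplex_cat_def)

lemma simplex_cat_dom_cod:
  "a \<in> Arr (simplex_cat B k) \<Longrightarrow>
    Dom (simplex_cat B k) a \<in> Obj (simplex_cat B k) \<and> Cod (simplex_cat B k) a \<in> Obj (simplex_cat B k)"
  by (cases a) auto

lemma simplex_homD:
  assumes "f \<in> simplex_hom B x y"
  shows "i \<le> dim x \<Longrightarrow> f i \<le> dim y"
    and "i \<le> j \<Longrightarrow> j \<le> dim x \<Longrightarrow> f i \<le> f j"
    and "i \<le> dim x \<Longrightarrow> fst y ! f i = fst x ! i"
    and "i < dim x \<Longrightarrow> snd x ! i = segment B y (f i) (f (Suc i))"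
  using assms by (auto simp: simplex_hom_def mono_on_def PiE_iff)

lemma Dom_vertex [simp]: "Dom (simplex_cat B k) (vertex z i) = point (fst z ! i)"
  and Cod_vertex [simp]: "Cod (simplex_cat B k) (vertex z i) = z"
  by (simp_all add: vertex_def)

lemma Dom_chord [simp]: "Dom (simplex_cat B k) (chord B z i j) = edge B (segment B z i j)"
  and Cod_chord [simp]: "Cod (simplex_cat B k) (chord B z i j) = z"
  by (simp_all add: chord_def)

lemma eps_arr_vertex [simp]: "eps_arr B (vertex z i) = segment B z i (dim z)"
  by (simp add: eps_arr_def vertex_def)

lemma Cmp_vertex:
  "Cmp (simplex_cat B k) (x, h, y) (vertex x i) = (point (fst x ! i), \<lambda>_\<in>{..0}. h i, y)"
  by (auto simp: vertex_def compose_def fun_eq_iff)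

context category
begin

lemma string_obj: "y \<in> strings B \<Longrightarrow> i \<le> dim y \<Longrightarrow> fst y ! i \<in> Obj B"
  by (cases y) (auto simp: strings_def dim_def intro!: subsetD[OF _ nth_mem])

lemma string_arr:
  assumes "y \<in> strings B" and "i < dim y"
  shows "snd y ! i \<in> Arr B" and "Dom B (snd y ! i) = fst y ! i" and "Cod B (snd y ! i) = fst y ! Suc i"
  using assms by (auto simp: strings_def dim_def)

lemma eps_obj_closed: "y \<in> strings B \<Longrightarrow> eps_obj y \<in> Obj B"
  by (simp add: eps_obj_def string_obj)

lemma segment_props:
  assumes "y \<in> strings B" and "i \<le> j" and "j \<le> dim y"
  shows "segment B y i j \<in> Arr B \<and> Dom B (segment B y i j) = fst y ! i \<and> Cod B (segment B y i j) = fst y ! j"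
  using assms(2,3)
proof (induction j rule: dec_induct)
  case base
  then show ?case using string_obj[OF assms(1)] ide_closed dom_ide cod_ide by simp
next
  case (step j)
  then show ?case
    using string_arr[OF assms(1), of j] by (simp add: segment_Suc cmp_closed dom_cmp cod_cmp)
qed

lemma segment_arr: "y \<in> strings B \<Longrightarrow> i \<le> j \<Longrightarrow> j \<le> dim y \<Longrightarrow> segment B y i j \<in> Arr B"
  and Dom_segment: "y \<in> strings B \<Longrightarrow> i \<le> j \<Longrightarrow> j \<le> dim y \<Longrightarrow> Dom B (segment B y i j) = fst y ! i"
  and Cod_segment: "y \<in> strings B \<Longrightarrow> i \<le> j \<Longrightarrow> j \<le> dim y \<Longrightarrow> Cod B (segment B y i j) = fst y ! j"
  using segment_props by blast+

lemma segment_trans: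
  assumes y: "y \<in> strings B" and "i \<le> j" and "j \<le> l" and "l \<le> dim y"
  shows "segment B y i l = Cmp B (segment B y j l) (segment B y i j)"
  using assms(3,4)
proof (induction l rule: dec_induct)
  case base
  then show ?case
    using cmp_ide_left[OF segment_arr[OF y assms(2)]] Cod_segment[OF y assms(2)] by simp
next
  case (step l)
  have "Cmp B (Cmp B (snd y ! l) (segment B y j l)) (segment B y i j) =
      Cmp B (snd y ! l) (Cmp B (segment B y j l) (segment B y i j))"
    by (rule cmp_assoc[symmetric])
      (use y assms(2) step in \<open>auto simp: segment_arr Dom_segment Cod_segment string_arr\<close>)
  then show ?case
    using step assms(2) by (simp add: segment_Suc)
qed

lemma segment_one:
  assumes "y \<in> strings B" and "i < dim y"
  shows "segment B y i (Suc i) = snd y ! i"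
  using cmp_ide_right[OF string_arr(1)[OF assms]] string_arr(2)[OF assms]
  by (simp add: segment_Suc)

text \<open>A morphism of strings is required to respect single arrows only; it then respects all composites,
  which is what makes \<open>\<epsilon>\<close> a functor.\<close>

lemma segment_hom:
  assumes y: "y \<in> strings B" and f: "f \<in> simplex_hom B x y" and "i \<le> j" and "j \<le> dim x"
  shows "segment B x i j = segment B y (f i) (f j)"
  using assms(3,4)
proof (induction j rule: dec_induct)
  case base
  then show ?case using simplex_homD(3)[OF f] by simp
next
  case (step j)
  then show ?case
    using segment_trans[OF y, of "f i" "f j" "f (Suc j)"] simplex_homD[OF f]
    by (simp add: segment_Suc)
qed

lemma point_string: "x \<in> Obj B \<Longrightarrow> point x \<in> strings B"
  by (simp add: strings_def point_def)

lemma edge_string: "f \<in> Arr B \<Longrightarrow> edge B f \<in> strings B"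
  by (simp add: strings_def edge_def dom_closed cod_closed)

lemma triangle_string:
  "f \<in> Arr B \<Longrightarrow> g \<in> Arr B \<Longrightarrow> Dom B g = Cod B f \<Longrightarrow> triangle B f g \<in> strings B"
  by (auto simp: strings_def triangle_def dom_closed cod_closed less_Suc_eq)

lemma segment_edge: "f \<in> Arr B \<Longrightarrow> segment B (edge B f) 0 1 = f"
  using segment_one[OF edge_string, of f 0] by (simp add: edge_def dim_def)

lemma segment_triangle:
  assumes "f \<in> Arr B" and "g \<in> Arr B" and "Dom B g = Cod B f"
  shows "segment B (triangle B f g) 0 1 = f" and "segment B (triangle B f g) 1 2 = g"
    and "segment B (triangle B f g) 0 2 = Cmp B g f"
proof -
  note T = triangle_string[OF assms]
  show 1: "segment B (triangle B f g) 0 1 = f" and 2: "segment B (triangle B f g) 1 2 = g"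
    using segment_one[OF T, of 0] segment_one[OF T, of 1] by (simp_all add: triangle_def dim_def numeral_2_eq_2)
  show "segment B (triangle B f g) 0 2 = Cmp B g f"
    using segment_trans[OF T, of 0 1 2] 1 2 by simp
qed

lemma vertex_arr:
  assumes "z \<in> Obj (simplex_cat B k)" and "i \<le> dim z"
  shows "vertex z i \<in> Arr (simplex_cat B k)"
  using assms point_string[OF string_obj[of z i]]
  by (auto simp: vertex_def simplex_hom_def mono_on_def zero_enat_def[symmetric])

lemma chord_arr:
  assumes z: "z \<in> Obj (simplex_cat B k)" and ij: "i \<le> j" "j \<le> dim z" and k: "k \<ge> 2"
  shows "chord B z i j \<in> Arr (simplex_cat B k)"
proof -
  have zs: "z \<in> strings B" "enat (dim z) \<le> k" using z by auto
  have "enat 1 \<le> k"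
    using k order_trans[of "enat 1" "enat 2" k] by (simp add: numeral_eq_enat)
  moreover have "(\<lambda>l\<in>{..1}. if l = 0 then i else j) \<in> simplex_hom B (edge B (segment B z i j)) z"
    using zs ij by (auto simp: simplex_hom_def mono_on_def edge_def dim_def le_Suc_eq Dom_segment Cod_segment)
  ultimately show ?thesis
    using zs edge_string[OF segment_arr[OF zs(1) ij]] by (simp add: chord_def)
qed

text \<open>Both vertices \<open>[z\<^sub>i]\<close> and \<open>[z\<^sub>j]\<close> of \<open>z\<close> factor through the chord; these are the relations between the
  arrows of \<open>N(B)\<close> on which descent rests.\<close>

lemma Cmp_chord_vertex:
  assumes "z \<in> strings B" and "i \<le> j" and "j \<le> dim z"
  shows "Cmp (simplex_cat B k) (chord B z i j) (vertex (edge B (segment B z i j)) 0) = vertex z i"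
    and "Cmp (simplex_cat B k) (chord B z i j) (vertex (edge B (segment B z i j)) 1) = vertex z j"
  using assms unfolding chord_def Cmp_vertex
  by (simp_all add: vertex_def edge_def Dom_segment Cod_segment)

lemma Cmp_arr_vertex:
  assumes "(x, h, y) \<in> Arr (simplex_cat B k)" and "i \<le> dim x"
  shows "Cmp (simplex_cat B k) (x, h, y) (vertex x i) = vertex y (h i)"
  using assms simplex_homD(3)[of h B x y i] unfolding Cmp_vertex by (simp add: vertex_def)

lemma eps_arr_closed:
  assumes "a \<in> Arr (simplex_cat B k)"
  shows "eps_arr B a \<in> Arr B"
    and "Dom B (eps_arr B a) = eps_obj (Dom (simplex_cat B k) a)"
    and "Cod B (eps_arr B a) = eps_obj (Cod (simplex_cat B k) a)"
proof -
  obtain x f y where a: "a = (x, f, y)" by (cases a)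
  have "y \<in> strings B" "f \<in> simplex_hom B x y" using assms a by auto
  then show "eps_arr B a \<in> Arr B"
    and "Dom B (eps_arr B a) = eps_obj (Dom (simplex_cat B k) a)"
    and "Cod B (eps_arr B a) = eps_obj (Cod (simplex_cat B k) a)"
    using simplex_homD[of f B x y]
    by (simp_all add: a eps_arr_def eps_obj_def segment_arr Dom_segment Cod_segment)
qed

lemma eps_arr_Ide: "eps_arr B (Ide (simplex_cat B k) x) = Ide B (eps_obj x)"
  by (simp add: eps_arr_def eps_obj_def)

lemma eps_arr_Cmp:
  assumes a: "a \<in> Arr (simplex_cat B k)" and b: "b \<in> Arr (simplex_cat B k)"
    and "Dom (simplex_cat B k) b = Cod (simplex_cat B k) a"
  shows "eps_arr B (Cmp (simplex_cat B k) b a) = Cmp B (eps_arr B b) (eps_arr B a)"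
proof -
  obtain x f y where a': "a = (x, f, y)" by (cases a)
  with assms(3) obtain g z where b': "b = (y, g, z)" by (cases b) auto
  have f: "f \<in> simplex_hom B x y" and g: "g \<in> simplex_hom B y z" and z: "z \<in> strings B"
    using a b a' b' by auto
  have fx: "f (dim x) \<le> dim y" using simplex_homD(1)[OF f] by simp
  have "segment B z (g (f (dim x))) (dim z) =
      Cmp B (segment B z (g (dim y)) (dim z)) (segment B z (g (f (dim x))) (g (dim y)))"
    by (rule segment_trans[OF z]) (use simplex_homD[OF g] fx in auto)
  also have "segment B z (g (f (dim x))) (g (dim y)) = segment B y (f (dim x)) (dim y)"
    using segment_hom[OF z g fx] by simp
  finally show ?thesis by (simp add: a' b' eps_arr_def compose_def)
qed

lemma eps_alg_diagram:
  assumes "alg_diagram B A F"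
  shows "alg_diagram (simplex_cat B k) A (eps_diagram B F)"
proof -
  let ?N = "simplex_cat B k"
  have "algebra A (dobj (eps_diagram B F) x)" if "x \<in> Obj ?N" for x
    using assms that eps_obj_closed by (simp add: alg_diagram_def eps_diagram_def)
  moreover have "darr (eps_diagram B F) a \<in>
      alg_hom A (dobj (eps_diagram B F) (Dom ?N a)) (dobj (eps_diagram B F) (Cod ?N a))"
    if "a \<in> Arr ?N" for a
  proof -
    have "darr F (eps_arr B a) \<in> alg_hom A (dobj F (Dom B (eps_arr B a))) (dobj F (Cod B (eps_arr B a)))"
      using assms eps_arr_closed(1)[OF that] by (simp add: alg_diagram_def)
    then show ?thesis
      by (simp add: eps_diagram_def eps_arr_closed(2,3)[OF that])
  qed
  moreover have "darr (eps_diagram B F) (Ide ?N x) s = s"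
    if "x \<in> Obj ?N" "s \<in> carrier (dobj (eps_diagram B F) x)" for x s
    using assms that eps_obj_closed by (simp add: alg_diagram_def eps_diagram_def eps_arr_Ide del: simplex_cat_simps(5))
  moreover have "darr (eps_diagram B F) (Cmp ?N b a) s = darr (eps_diagram B F) b (darr (eps_diagram B F) a s)"
    if "a \<in> Arr ?N" "b \<in> Arr ?N" "Dom ?N b = Cod ?N a" "s \<in> carrier (dobj (eps_diagram B F) (Dom ?N a))" for a b s
    using assms that eps_arr_closed[OF that(1)] eps_arr_closed[OF that(2)]
    by (simp add: alg_diagram_def eps_diagram_def eps_arr_Cmp)
  ultimately show ?thesis
    unfolding alg_diagram_def by blast
qed

end

section \<open>Isomorphisms of deformations\<close>

lemma alg_homD:
  assumes "h \<in> alg_hom A M N"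
  shows "x \<in> carrier M \<Longrightarrow> h x \<in> carrier N"
    and "x \<in> carrier M \<Longrightarrow> y \<in> carrier M \<Longrightarrow> h (x \<otimes>\<^bsub>M\<^esub> y) = h x \<otimes>\<^bsub>N\<^esub> h y"
    and "x \<in> carrier M \<Longrightarrow> y \<in> carrier M \<Longrightarrow> h (x \<oplus>\<^bsub>M\<^esub> y) = h x \<oplus>\<^bsub>N\<^esub> h y"
    and "h \<one>\<^bsub>M\<^esub> = \<one>\<^bsub>N\<^esub>"
    and "a \<in> carrier A \<Longrightarrow> x \<in> carrier M \<Longrightarrow> h (a \<odot>\<^bsub>M\<^esub> x) = a \<odot>\<^bsub>N\<^esub> h x"
  using assms by (auto simp: alg_hom_def ring_hom_def)

lemma alg_homI:
  assumes "\<And>x. x \<in> carrier M \<Longrightarrow> h x \<in> carrier N"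
    and "\<And>x y. x \<in> carrier M \<Longrightarrow> y \<in> carrier M \<Longrightarrow> h (x \<otimes>\<^bsub>M\<^esub> y) = h x \<otimes>\<^bsub>N\<^esub> h y"
    and "\<And>x y. x \<in> carrier M \<Longrightarrow> y \<in> carrier M \<Longrightarrow> h (x \<oplus>\<^bsub>M\<^esub> y) = h x \<oplus>\<^bsub>N\<^esub> h y"
    and "h \<one>\<^bsub>M\<^esub> = \<one>\<^bsub>N\<^esub>"
    and "\<And>a x. a \<in> carrier A \<Longrightarrow> x \<in> carrier M \<Longrightarrow> h (a \<odot>\<^bsub>M\<^esub> x) = a \<odot>\<^bsub>N\<^esub> h x"
  shows "h \<in> alg_hom A M N"
  using assms by (auto simp: alg_hom_def ring_hom_def)

lemma alg_iso_closed: "h \<in> alg_iso A M N \<Longrightarrow> x \<in> carrier M \<Longrightarrow> h x \<in> carrier N"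
  by (auto simp: alg_iso_def bij_betw_def)

lemma alg_hom_comp:
  assumes "h \<in> alg_hom A M N" and "g \<in> alg_hom A N P"
  shows "(\<lambda>x. g (h x)) \<in> alg_hom A M P"
  by (rule alg_homI) (simp_all add: alg_homD[OF assms(1)] alg_homD[OF assms(2)])

lemma alg_iso_comp:
  assumes "h \<in> alg_iso A M N" and "g \<in> alg_iso A N P"
  shows "(\<lambda>x. g (h x)) \<in> alg_iso A M P"
  using assms alg_hom_comp[of h A M N g P]
    bij_betw_trans[of h "carrier M" "carrier N" g "carrier P"]
  by (simp add: alg_iso_def comp_def)

lemma alg_iso_inv:
  assumes M: "algebra A M" and h: "h \<in> alg_iso A M N"
  shows "inv_into (carrier M) h \<in> alg_iso A N M"
    and "x \<in> carrier M \<Longrightarrow> inv_into (carrier M) h (h x) = x"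
    and "y \<in> carrier N \<Longrightarrow> inv_into (carrier M) h y \<in> carrier M"
    and "y \<in> carrier N \<Longrightarrow> h (inv_into (carrier M) h y) = y"
proof -
  let ?g = "inv_into (carrier M) h"
  interpret M: algebra A M by fact
  have hom: "h \<in> alg_hom A M N" and bij: "bij_betw h (carrier M) (carrier N)"
    using h by (auto simp: alg_iso_def)
  note H = alg_homD[OF hom]
  show l: "?g (h x) = x" if "x \<in> carrier M" for x
    using bij_betw_inv_into_left[OF bij that] .
  show c: "?g y \<in> carrier M" if "y \<in> carrier N" for y
    using bij_betwE[OF bij_betw_inv_into[OF bij]] that by blast
  show r: "h (?g y) = y" if "y \<in> carrier N" for y
    using bij_betw_inv_into_right[OF bij that] .
  have eq: "?g y = x" if "x \<in> carrier M" "h x = y" for x y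
    using l that by blast
  have "?g \<in> alg_hom A N M"
  proof (rule alg_homI)
    show "?g (x \<otimes>\<^bsub>N\<^esub> y) = ?g x \<otimes>\<^bsub>M\<^esub> ?g y" if "x \<in> carrier N" "y \<in> carrier N" for x y
      by (rule eq) (use that c r H in auto)
    show "?g (x \<oplus>\<^bsub>N\<^esub> y) = ?g x \<oplus>\<^bsub>M\<^esub> ?g y" if "x \<in> carrier N" "y \<in> carrier N" for x y
      by (rule eq) (use that c r H in auto)
    show "?g \<one>\<^bsub>N\<^esub> = \<one>\<^bsub>M\<^esub>"
      by (rule eq) (use H in auto)
    show "?g (a \<odot>\<^bsub>N\<^esub> x) = a \<odot>\<^bsub>M\<^esub> ?g x" if "a \<in> carrier A" "x \<in> carrier N" for a x
      by (rule eq) (use that c r H in auto)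
  qed (rule c)
  then show "?g \<in> alg_iso A N M"
    using bij_betw_inv_into[OF bij] by (simp add: alg_iso_def)
qed

lemma alg_diagramD:
  assumes "alg_diagram D A F"
  shows "x \<in> Obj D \<Longrightarrow> algebra A (dobj F x)"
    and "f \<in> Arr D \<Longrightarrow> darr F f \<in> alg_hom A (dobj F (Dom D f)) (dobj F (Cod D f))"
    and "x \<in> Obj D \<Longrightarrow> s \<in> carrier (dobj F x) \<Longrightarrow> darr F (Ide D x) s = s"
    and "f \<in> Arr D \<Longrightarrow> g \<in> Arr D \<Longrightarrow> Dom D g = Cod D f \<Longrightarrow> s \<in> carrier (dobj F (Dom D f)) \<Longrightarrow>
      darr F (Cmp D g f) s = darr F g (darr F f s)"
  using assms by (auto simp: alg_diagram_def)

lemma defo_isoI: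
  assumes "(F, \<phi>) \<in> deformations D K A S" and "(F', \<psi>) \<in> deformations D K A S"
    and "\<And>x. x \<in> Obj D \<Longrightarrow> \<eta> x \<in> alg_iso A (dobj F x) (dobj F' x)"
    and "\<And>f s. f \<in> Arr D \<Longrightarrow> s \<in> carrier (dobj F (Dom D f)) \<Longrightarrow>
      \<eta> (Cod D f) (darr F f s) = darr F' f (\<eta> (Dom D f) s)"
    and "\<And>x s. x \<in> Obj D \<Longrightarrow> s \<in> carrier (dobj F x) \<Longrightarrow> \<psi> x (\<eta> x s) = \<phi> x s"
  shows "((F, \<phi>), (F', \<psi>)) \<in> defo_iso D K A S"
proof -
  have "\<eta> \<in> diagram_iso D A F F'"
    using assms(3,4) by (simp add: diagram_iso_def diagram_hom_def alg_iso_def)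
  then show ?thesis
    using assms(1,2,5) by (auto simp: defo_iso_def intro!: bexI[of _ \<eta>])
qed

lemma defo_isoE:
  assumes "((F, \<phi>), (F', \<psi>)) \<in> defo_iso D K A S"
  obtains \<eta> where "\<forall>x\<in>Obj D. \<eta> x \<in> alg_iso A (dobj F x) (dobj F' x)"
    and "\<forall>f\<in>Arr D. \<forall>s\<in>carrier (dobj F (Dom D f)). \<eta> (Cod D f) (darr F f s) = darr F' f (\<eta> (Dom D f) s)"
    and "\<forall>x\<in>Obj D. \<forall>s\<in>carrier (dobj F x). \<psi> x (\<eta> x s) = \<phi> x s"
proof -
  obtain \<eta> where "\<eta> \<in> diagram_iso D A F F'" "\<forall>x \<in> Obj D. \<forall>s \<in> carrier (dobj F x). \<phi> x s = \<psi> x (\<eta> x s)"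
    using assms by (auto simp: defo_iso_def)
  then show thesis
    using that[of \<eta>] by (simp add: diagram_iso_def diagram_hom_def)
qed

lemma equiv_defo_iso:
  assumes ends: "\<And>f. f \<in> Arr D \<Longrightarrow> Dom D f \<in> Obj D \<and> Cod D f \<in> Obj D"
  shows "equiv (deformations D K A S) (defo_iso D K A S)"
proof (rule equivI)
  show "defo_iso D K A S \<subseteq> deformations D K A S \<times> deformations D K A S"
    by (auto simp: defo_iso_def)
  show "refl_on (deformations D K A S) (defo_iso D K A S)"
  proof (rule refl_onI)
    fix d assume "d \<in> deformations D K A S"
    moreover obtain F \<phi> where "d = (F, \<phi>)" by (cases d)
    ultimately show "(d, d) \<in> defo_iso D K A S"
      by (auto intro!: defo_isoI[where \<eta> = "\<lambda>_ s. s"] simp: alg_iso_def alg_hom_def ring_hom_def bij_betw_def inj_on_def)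
  qed
  show "sym (defo_iso D K A S)"
  proof (rule symI)
    fix d d' assume dd: "(d, d') \<in> defo_iso D K A S"
    obtain F \<phi> F' \<psi> where d: "d = (F, \<phi>)" "d' = (F', \<psi>)" by (cases d; cases d') auto
    obtain \<eta> where isos: "\<forall>x\<in>Obj D. \<eta> x \<in> alg_iso A (dobj F x) (dobj F' x)"
      and nat: "\<forall>f\<in>Arr D. \<forall>s\<in>carrier (dobj F (Dom D f)).
        \<eta> (Cod D f) (darr F f s) = darr F' f (\<eta> (Dom D f) s)"
      and over: "\<forall>x\<in>Obj D. \<forall>s\<in>carrier (dobj F x). \<psi> x (\<eta> x s) = \<phi> x s"
      by (rule defo_isoE[OF dd[unfolded d]])
    have \<eta>: "\<eta> x \<in> alg_iso A (dobj F x) (dobj F' x)" if "x \<in> Obj D" for x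
      using isos that by blast
    have defs: "(F, \<phi>) \<in> deformations D K A S" "(F', \<psi>) \<in> deformations D K A S"
      using dd d by (auto simp: defo_iso_def)
    then have F: "alg_diagram D A F" by (simp add: deformations_def)
    define \<theta> where "\<theta> x = inv_into (carrier (dobj F x)) (\<eta> x)" for x
    note inv = alg_iso_inv[OF alg_diagramD(1)[OF F] \<eta>, folded \<theta>_def]
    have "((F', \<psi>), (F, \<phi>)) \<in> defo_iso D K A S"
    proof (rule defo_isoI[OF defs(2,1)])
      show "\<theta> x \<in> alg_iso A (dobj F' x) (dobj F x)" if "x \<in> Obj D" for x
        using inv(1) that by blast
      show "\<theta> (Cod D f) (darr F' f s) = darr F f (\<theta> (Dom D f) s)"
        if "f \<in> Arr D" "s \<in> carrier (dobj F' (Dom D f))" for f s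
      proof -
        have e: "Dom D f \<in> Obj D" "Cod D f \<in> Obj D" using ends that(1) by auto
        let ?t = "\<theta> (Dom D f) s"
        have t: "?t \<in> carrier (dobj F (Dom D f))" "\<eta> (Dom D f) ?t = s"
          using inv(3,4) e(1) that(2) by auto
        then have "\<theta> (Cod D f) (darr F' f s) = \<theta> (Cod D f) (\<eta> (Cod D f) (darr F f ?t))"
          using nat that(1) t by simp
        also have "\<dots> = darr F f ?t"
          using inv(2)[OF e(2,2)] alg_homD(1)[OF alg_diagramD(2)[OF F that(1)] t(1)] by blast
        finally show ?thesis .
      qed
      show "\<phi> x (\<theta> x s) = \<psi> x s" if "x \<in> Obj D" "s \<in> carrier (dobj F' x)" for x s
        using over that(1) inv(3,4)[OF that(1) that] by metis
    qed
    then show "(d', d) \<in> defo_iso D K A S" using d by simp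
  qed
  show "trans (defo_iso D K A S)"
  proof (rule transI)
    fix d d' d'' assume dd: "(d, d') \<in> defo_iso D K A S" "(d', d'') \<in> defo_iso D K A S"
    obtain F \<phi> F' \<psi> F'' \<chi> where d: "d = (F, \<phi>)" "d' = (F', \<psi>)" "d'' = (F'', \<chi>)"
      by (cases d; cases d'; cases d'') auto
    obtain \<eta> where \<eta>: "\<forall>x\<in>Obj D. \<eta> x \<in> alg_iso A (dobj F x) (dobj F' x)"
      "\<forall>f\<in>Arr D. \<forall>s\<in>carrier (dobj F (Dom D f)). \<eta> (Cod D f) (darr F f s) = darr F' f (\<eta> (Dom D f) s)"
      "\<forall>x\<in>Obj D. \<forall>s\<in>carrier (dobj F x). \<psi> x (\<eta> x s) = \<phi> x s"
      by (rule defo_isoE[OF dd(1)[unfolded d]])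
    obtain \<theta> where \<theta>: "\<forall>x\<in>Obj D. \<theta> x \<in> alg_iso A (dobj F' x) (dobj F'' x)"
      "\<forall>f\<in>Arr D. \<forall>s\<in>carrier (dobj F' (Dom D f)). \<theta> (Cod D f) (darr F' f s) = darr F'' f (\<theta> (Dom D f) s)"
      "\<forall>x\<in>Obj D. \<forall>s\<in>carrier (dobj F' x). \<chi> x (\<theta> x s) = \<psi> x s"
      by (rule defo_isoE[OF dd(2)[unfolded d]])
    have c: "\<eta> x s \<in> carrier (dobj F' x)" if "x \<in> Obj D" "s \<in> carrier (dobj F x)" for x s
      using alg_iso_closed[OF bspec[OF \<eta>(1) that(1)] that(2)] .
    show "(d, d'') \<in> defo_iso D K A S"
      unfolding d
    proof (rule defo_isoI[where \<eta> = "\<lambda>x s. \<theta> x (\<eta> x s)"])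
      show "(F, \<phi>) \<in> deformations D K A S" "(F'', \<chi>) \<in> deformations D K A S"
        using dd d by (auto simp: defo_iso_def)
      show "(\<lambda>s. \<theta> x (\<eta> x s)) \<in> alg_iso A (dobj F x) (dobj F'' x)" if "x \<in> Obj D" for x
        using alg_iso_comp[OF bspec[OF \<eta>(1) that] bspec[OF \<theta>(1) that]] .
      show "\<theta> (Cod D f) (\<eta> (Cod D f) (darr F f s)) = darr F'' f (\<theta> (Dom D f) (\<eta> (Dom D f) s))"
        if "f \<in> Arr D" "s \<in> carrier (dobj F (Dom D f))" for f s
        using \<eta>(2) \<theta>(2) c[of "Dom D f" s] ends[OF that(1)] that by simp
      show "\<chi> x (\<theta> x (\<eta> x s)) = \<phi> x s" if "x \<in> Obj D" "s \<in> carrier (dobj F x)" for x s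
        using \<eta>(3) \<theta>(3) c that by simp
    qed
  qed
qed

text \<open>A map that preserves and reflects equivalence and reaches every class induces a bijection on classes;
  the class of the image is the saturation of the image of a class.\<close>

lemma quotient_bij_betw:
  assumes R: "equiv X R" and Q: "equiv Y Q" and f: "\<And>x. x \<in> X \<Longrightarrow> f x \<in> Y"
    and iff: "\<And>x x'. x \<in> X \<Longrightarrow> x' \<in> X \<Longrightarrow> (f x, f x') \<in> Q \<longleftrightarrow> (x, x') \<in> R"
    and surj: "\<And>y. y \<in> Y \<Longrightarrow> \<exists>x\<in>X. (f x, y) \<in> Q"
  shows "bij_betw (\<lambda>C. Q `` (f ` C)) (X // R) (Y // Q)"
proof -
  have img: "Q `` (f ` (R `` {x})) = Q `` {f x}" if x: "x \<in> X" for x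
  proof
    show "Q `` {f x} \<subseteq> Q `` (f ` (R `` {x}))"
      using equiv_class_self[OF R x] by blast
    show "Q `` (f ` (R `` {x})) \<subseteq> Q `` {f x}"
    proof
      fix y assume "y \<in> Q `` (f ` (R `` {x}))"
      then obtain x' where x': "(x, x') \<in> R" "(f x', y) \<in> Q" by blast
      then have "x' \<in> X" using R by (auto simp: equiv_def)
      then have "(f x, f x') \<in> Q" using iff x x'(1) by blast
      then show "y \<in> Q `` {f x}" using x'(2) Q by (auto simp: equiv_def dest: transD)
    qed
  qed
  show ?thesis
    unfolding bij_betw_def
  proof (rule conjI)
    show "inj_on (\<lambda>C. Q `` (f ` C)) (X // R)"
    proof (rule inj_onI)
      fix C C' assume CC: "C \<in> X // R" "C' \<in> X // R" "Q `` (f ` C) = Q `` (f ` C')"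
      obtain x x' where x: "x \<in> X" "C = R `` {x}" and x': "x' \<in> X" "C' = R `` {x'}"
        using CC(1,2) by (auto elim!: quotientE)
      have "Q `` {f x} = Q `` {f x'}" using CC(3) img x x' by simp
      then have "(f x, f x') \<in> Q" using eq_equiv_class[OF _ Q f[OF x'(1)]] by blast
      then have "(x, x') \<in> R" using iff x x' by blast
      then show "C = C'" using equiv_class_eq[OF R] x x' by blast
    qed
    show "(\<lambda>C. Q `` (f ` C)) ` (X // R) = Y // Q"
    proof (rule subset_antisym; rule subsetI)
      fix E assume "E \<in> (\<lambda>C. Q `` (f ` C)) ` (X // R)"
      then obtain x where "x \<in> X" "E = Q `` (f ` (R `` {x}))" by (auto elim!: quotientE)
      then show "E \<in> Y // Q" using img f by (auto intro: quotientI)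
    next
      fix E assume "E \<in> Y // Q"
      then obtain y where y: "y \<in> Y" "E = Q `` {y}" by (auto elim!: quotientE)
      then obtain x where x: "x \<in> X" "(f x, y) \<in> Q" using surj by blast
      then have "E = Q `` (f ` (R `` {x}))" using img y equiv_class_eq[OF Q x(2)] by simp
      then show "E \<in> (\<lambda>C. Q `` (f ` C)) ` (X // R)" by (rule image_eqI[OF _ quotientI[OF x(1)]])
    qed
  qed
qed

section \<open>Pullback along \<open>\<epsilon>\<close> and descent\<close>

text \<open>Apart from the diagram itself, a deformation is naturality of \<open>\<phi>\<close> plus a condition at each object.\<close>

lemma (in artin_algebra) deformations_iff:
  assumes "alg_diagram D K S"
  shows "(F, \<phi>) \<in> deformations D K A S \<longleftrightarrow> alg_diagram D A F \<and>
    (\<forall>f\<in>Arr D. \<forall>s\<in>carrier (dobj F (Dom D f)). \<phi> (Cod D f) (darr F f s) = darr S f (\<phi> (Dom D f) s)) \<and>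
    (\<forall>x\<in>Obj D. is_reduction (dobj F x) (dobj S x) (\<phi> x))"
  using assms unfolding deformations_def is_reduction_def diagram_hom_def diagram_via_augment_def alg_diagram_def
  by auto

lemma eps_diagram_simps [simp]:
  "dobj (eps_diagram B F) x = dobj F (eps_obj x)"
  "darr (eps_diagram B F) a = darr F (eps_arr B a)"
  by (simp_all add: eps_diagram_def)

locale deformation_setup = artin_algebra K A + category B
  for K :: "'k ring" and A :: "('k, 'a) module" and B :: "('o, 'm) cat" +
  fixes S :: "('o, 'm, 'k, 's) diagram" and k :: enat
  assumes S: "alg_diagram B K S" and k: "k \<ge> 2"
begin

abbreviation N where "N \<equiv> simplex_cat B k"

abbreviation epsS where "epsS \<equiv> eps_diagram B S"

lemma epsS: "alg_diagram N K epsS"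
  by (rule eps_alg_diagram[OF S])

lemma small_dims: "enat 0 \<le> k" "enat 1 \<le> k" "enat 2 \<le> k"
  using k order_trans[of "enat 1" "enat 2" k] by (simp_all add: numeral_eq_enat zero_enat_def[symmetric])

lemma point_obj: "x \<in> Obj B \<Longrightarrow> point x \<in> Obj N"
  and edge_obj: "f \<in> Arr B \<Longrightarrow> edge B f \<in> Obj N"
  and triangle_obj: "f \<in> Arr B \<Longrightarrow> g \<in> Arr B \<Longrightarrow> Dom B g = Cod B f \<Longrightarrow> triangle B f g \<in> Obj N"
  using small_dims by (simp_all add: point_string edge_string triangle_string)

lemma eps_defo_closed:
  assumes "(F, \<phi>) \<in> deformations B K A S"
  shows "eps_defo B (F, \<phi>) \<in> deformations N K A epsS"
proof -
  have F: "alg_diagram B A F"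
    and nat: "\<forall>f\<in>Arr B. \<forall>s\<in>carrier (dobj F (Dom B f)). \<phi> (Cod B f) (darr F f s) = darr S f (\<phi> (Dom B f) s)"
    and red: "\<forall>x\<in>Obj B. is_reduction (dobj F x) (dobj S x) (\<phi> x)"
    using assms by (auto simp: deformations_iff[OF S])
  have "\<phi> (eps_obj (Cod N a)) (darr F (eps_arr B a) s) = darr S (eps_arr B a) (\<phi> (eps_obj (Dom N a)) s)"
    if "a \<in> Arr N" "s \<in> carrier (dobj F (eps_obj (Dom N a)))" for a s
    using bspec[OF nat eps_arr_closed(1)[OF that(1)]] that(2) eps_arr_closed[OF that(1)] by simp
  then show ?thesis
    using red eps_alg_diagram[OF F] eps_obj_closed
    by (simp add: eps_defo_def deformations_iff[OF epsS])
qed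

lemma eps_defo_iso:
  assumes "((F, \<phi>), (F', \<psi>)) \<in> defo_iso B K A S"
  shows "(eps_defo B (F, \<phi>), eps_defo B (F', \<psi>)) \<in> defo_iso N K A epsS"
proof -
  have d: "(F, \<phi>) \<in> deformations B K A S" "(F', \<psi>) \<in> deformations B K A S"
    using assms by (auto simp: defo_iso_def)
  obtain \<eta> where \<eta>: "\<forall>x\<in>Obj B. \<eta> x \<in> alg_iso A (dobj F x) (dobj F' x)"
      "\<forall>f\<in>Arr B. \<forall>s\<in>carrier (dobj F (Dom B f)). \<eta> (Cod B f) (darr F f s) = darr F' f (\<eta> (Dom B f) s)"
      "\<forall>x\<in>Obj B. \<forall>s\<in>carrier (dobj F x). \<psi> x (\<eta> x s) = \<phi> x s"
    by (rule defo_isoE[OF assms])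
  show ?thesis
    unfolding eps_defo_def prod.case
  proof (rule defo_isoI[where \<eta> = "\<lambda>x. \<eta> (eps_obj x)"])
    show "(eps_diagram B F, \<lambda>x. \<phi> (eps_obj x)) \<in> deformations N K A epsS"
      "(eps_diagram B F', \<lambda>x. \<psi> (eps_obj x)) \<in> deformations N K A epsS"
      using eps_defo_closed[OF d(1)] eps_defo_closed[OF d(2)] by (simp_all add: eps_defo_def)
    show "\<eta> (eps_obj (Cod N a)) (darr (eps_diagram B F) a s) =
        darr (eps_diagram B F') a (\<eta> (eps_obj (Dom N a)) s)"
      if "a \<in> Arr N" "s \<in> carrier (dobj (eps_diagram B F) (Dom N a))" for a s
      using bspec[OF \<eta>(2) eps_arr_closed(1)[OF that(1)]] that(2) eps_arr_closed[OF that(1)] by simp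
  qed (use \<eta>(1,3) eps_obj_closed in auto)
qed

lemma eps_arr_last_vertex: "eps_arr B (vertex z (dim z)) = Ide B (eps_obj z)"
  by (simp add: eps_obj_def)

text \<open>An isomorphism \<open>\<eta>\<close> of pullbacks restricts to points. It is natural for \<open>f : x \<rightarrow> y\<close> because
  \<open>\<epsilon>\<close> maps \<open>[x] \<rightarrow> [x \<rightarrow> y] \<leftarrow> [y]\<close> to \<open>f\<close> and to the identity of \<open>y\<close>: the second arrow shows that \<open>\<eta>\<close> is
  the same at \<open>[x \<rightarrow> y]\<close> and at \<open>[y]\<close>, and naturality along the first is then naturality for \<open>f\<close>.\<close>

lemma eps_defo_reflects_iso:
  assumes d: "(F, \<phi>) \<in> deformations B K A S" "(F', \<psi>) \<in> deformations B K A S"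
    and "(eps_defo B (F, \<phi>), eps_defo B (F', \<psi>)) \<in> defo_iso N K A epsS"
  shows "((F, \<phi>), (F', \<psi>)) \<in> defo_iso B K A S"
proof -
  have F: "alg_diagram B A F" and F': "alg_diagram B A F'"
    using d by (auto simp: deformations_iff[OF S])
  obtain \<eta> where isos: "\<forall>x\<in>Obj N. \<eta> x \<in> alg_iso A (dobj (eps_diagram B F) x) (dobj (eps_diagram B F') x)"
    and nat: "\<forall>a\<in>Arr N. \<forall>s\<in>carrier (dobj (eps_diagram B F) (Dom N a)).
      \<eta> (Cod N a) (darr (eps_diagram B F) a s) = darr (eps_diagram B F') a (\<eta> (Dom N a) s)"
    and over: "\<forall>x\<in>Obj N. \<forall>s\<in>carrier (dobj (eps_diagram B F) x). \<psi> (eps_obj x) (\<eta> x s) = \<phi> (eps_obj x) s"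
    by (rule defo_isoE[OF assms(3)[unfolded eps_defo_def prod.case]])
  show ?thesis
  proof (rule defo_isoI[where \<eta> = "\<lambda>x. \<eta> (point x)"])
    show "(F, \<phi>) \<in> deformations B K A S" "(F', \<psi>) \<in> deformations B K A S" by (fact d)+
    show "\<eta> (point x) \<in> alg_iso A (dobj F x) (dobj F' x)" if "x \<in> Obj B" for x
      using bspec[OF isos point_obj[OF that]] by simp
    show "\<psi> x (\<eta> (point x) s) = \<phi> x s" if "x \<in> Obj B" "s \<in> carrier (dobj F x)" for x s
      using bspec[OF over point_obj[OF that(1)]] that(2) by simp
    show "\<eta> (point (Cod B f)) (darr F f s) = darr F' f (\<eta> (point (Dom B f)) s)"
      if f: "f \<in> Arr B" and s: "s \<in> carrier (dobj F (Dom B f))" for f s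
    proof -
      let ?e = "edge B f"
      have e: "?e \<in> Obj N" by (rule edge_obj[OF f])
      have ends: "fst ?e ! 0 = Dom B f" "fst ?e ! 1 = Cod B f" "eps_obj ?e = Cod B f"
        by (simp_all add: edge_def eps_obj_def dim_def)
      have v0: "vertex ?e 0 \<in> Arr N" and v1: "vertex ?e 1 \<in> Arr N"
        by (rule vertex_arr[OF e]; simp)+
      have eps: "eps_arr B (vertex ?e 0) = f" "eps_arr B (vertex ?e 1) = Ide B (Cod B f)"
        using segment_edge[OF f] eps_arr_last_vertex[of ?e] ends by simp_all
      note y = cod_closed[OF f]
      have Fs: "darr F f s \<in> carrier (dobj F (Cod B f))"
        using alg_homD(1)[OF alg_diagramD(2)[OF F f] s] .
      have \<eta>y: "\<eta> (point (Cod B f)) (darr F f s) \<in> carrier (dobj F' (Cod B f))"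
        using alg_iso_closed[OF bspec[OF isos point_obj[OF y]]] Fs by simp
      have "\<eta> ?e (darr F f s) = darr F' f (\<eta> (point (Dom B f)) s)"
        using bspec[OF nat v0] s ends eps by simp
      moreover have "\<eta> ?e (darr F (Ide B (Cod B f)) (darr F f s)) =
          darr F' (Ide B (Cod B f)) (\<eta> (point (Cod B f)) (darr F f s))"
        using bspec[OF nat v1] Fs ends eps by simp
      ultimately show ?thesis
        using alg_diagramD(3)[OF F y Fs] alg_diagramD(3)[OF F' y \<eta>y] by simp
    qed
  qed
qed

end

text \<open>A deformation \<open>(G, \<psi>)\<close> of \<open>\<epsilon>\<^sup>*S\<close>, to be descended to a deformation of \<open>S\<close>.\<close>

locale simplex_deformation = deformation_setup K A B S k
  for K :: "'k ring" and A :: "('k, 'a) module" and B :: "('o, 'm) cat"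
    and S :: "('o, 'm, 'k, 's) diagram" and k :: enat +
  fixes G :: "(('o, 'm) strng, ('o, 'm) strng_arr, 'a, 'c) diagram"
    and \<psi> :: "('o, 'm) strng \<Rightarrow> 'c \<Rightarrow> 's"
  assumes deformation: "(G, \<psi>) \<in> deformations N K A epsS"
begin

lemma G: "alg_diagram N A G"
  and natural: "a \<in> Arr N \<Longrightarrow> s \<in> carrier (dobj G (Dom N a)) \<Longrightarrow>
    \<psi> (Cod N a) (darr G a s) = darr S (eps_arr B a) (\<psi> (Dom N a) s)"
  and reduction: "x \<in> Obj N \<Longrightarrow> is_reduction (dobj G x) (dobj S (eps_obj x)) (\<psi> x)"
  using deformation by (simp_all add: deformations_iff[OF epsS])

text \<open>An arrow that \<open>\<epsilon>\<close> contracts to an identity becomes, in any deformation of \<open>\<epsilon>\<^sup>*S\<close>, a homomorphism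
  over the identity of an algebra of \<open>S\<close>, hence an isomorphism.\<close>

lemma iso_over_identity:
  assumes a: "a \<in> Arr N" and y: "eps_arr B a = Ide B y" "y \<in> Obj B"
  shows "darr G a \<in> alg_iso A (dobj G (Dom N a)) (dobj G (Cod N a))"
    and "s \<in> carrier (dobj G (Dom N a)) \<Longrightarrow> \<psi> (Cod N a) (darr G a s) = \<psi> (Dom N a) s"
proof -
  have ends: "eps_obj (Dom N a) = y" "eps_obj (Cod N a) = y"
    using eps_arr_closed[OF a] y dom_ide cod_ide by simp_all
  have obj: "Dom N a \<in> Obj N" "Cod N a \<in> Obj N"
    using simplex_cat_dom_cod[OF a] by auto
  show over: "\<psi> (Cod N a) (darr G a s) = \<psi> (Dom N a) s" if "s \<in> carrier (dobj G (Dom N a))" for s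
  proof -
    have "\<psi> (Dom N a) s \<in> carrier (dobj S y)"
      using is_reductionD(5)[OF reduction[OF obj(1)] that] ends by simp
    then show ?thesis
      using natural[OF a that] alg_diagramD(3)[OF S y(2)] y(1) by simp
  qed
  show "darr G a \<in> alg_iso A (dobj G (Dom N a)) (dobj G (Cod N a))"
    by (rule iso_of_reduction[OF reduction[OF obj(1)] _ alg_diagramD(2)[OF G a] over])
      (use reduction[OF obj(2)] ends in auto)
qed

abbreviation leg :: "('o, 'm) strng \<Rightarrow> nat \<Rightarrow> 'c \<Rightarrow> 'c" where
  "leg z i \<equiv> darr G (vertex z i)"

lemma leg_hom:
  "z \<in> Obj N \<Longrightarrow> i \<le> dim z \<Longrightarrow> leg z i \<in> alg_hom A (dobj G (point (fst z ! i))) (dobj G z)"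
  using alg_diagramD(2)[OF G vertex_arr[of z k i]] by simp

lemma last_leg_iso:
  assumes "z \<in> Obj N"
  shows "leg z (dim z) \<in> alg_iso A (dobj G (point (eps_obj z))) (dobj G z)"
    and "s \<in> carrier (dobj G (point (eps_obj z))) \<Longrightarrow> \<psi> z (leg z (dim z) s) = \<psi> (point (eps_obj z)) s"
  using iso_over_identity[OF vertex_arr[OF assms order_refl] eps_arr_last_vertex] assms
  by (simp_all add: eps_obj_closed flip: eps_obj_def)

lemma leg_arr:
  assumes "(x, h, y) \<in> Arr N" and "i \<le> dim x" and "s \<in> carrier (dobj G (point (fst x ! i)))"
  shows "darr G (x, h, y) (leg x i s) = leg y (h i) s"
proof -
  have "x \<in> Obj N" using assms(1) by simp
  from alg_diagramD(4)[OF G vertex_arr[OF this assms(2)] assms(1), of s] assms(3)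
  show ?thesis by (simp add: Cmp_arr_vertex[OF assms(1,2)])
qed

text \<open>The arrow \<open>f : x \<rightarrow> y\<close> acts by going along \<open>[x] \<rightarrow> [x \<rightarrow> y]\<close> and then back along the
  isomorphism attached to \<open>[y] \<rightarrow> [x \<rightarrow> y]\<close>.\<close>

definition descent_map :: "'m \<Rightarrow> 'c \<Rightarrow> 'c" where
  "descent_map f s = inv_into (carrier (dobj G (point (Cod B f)))) (leg (edge B f) 1) (leg (edge B f) 0 s)"

definition descent :: "('o, 'm, 'a, 'c) diagram" where
  "descent = \<lparr> dobj = (\<lambda>x. dobj G (point x)), darr = descent_map \<rparr>"

lemma edge_leg_iso:
  assumes "f \<in> Arr B"
  shows "leg (edge B f) 1 \<in> alg_iso A (dobj G (point (Cod B f))) (dobj G (edge B f))"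
  using last_leg_iso(1)[OF edge_obj[OF assms]] by (simp add: eps_obj_def) (simp add: edge_def)

lemma point_algebra: "x \<in> Obj B \<Longrightarrow> algebra A (dobj G (point x))"
  using alg_diagramD(1)[OF G point_obj] .

lemma descent_map_hom:
  assumes f: "f \<in> Arr B"
  shows "descent_map f \<in> alg_hom A (dobj G (point (Dom B f))) (dobj G (point (Cod B f)))"
proof -
  have "leg (edge B f) 0 \<in> alg_hom A (dobj G (point (Dom B f))) (dobj G (edge B f))"
    using leg_hom[OF edge_obj[OF f], of 0] by (simp add: edge_def)
  then show ?thesis
    unfolding descent_map_def
    by (rule alg_hom_comp)
      (use alg_iso_inv(1)[OF point_algebra[OF cod_closed[OF f]] edge_leg_iso[OF f]] in \<open>simp add: alg_iso_def\<close>)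
qed

lemma leg_descent_edge:
  assumes f: "f \<in> Arr B" and s: "s \<in> carrier (dobj G (point (Dom B f)))"
  shows "leg (edge B f) 1 (descent_map f s) = leg (edge B f) 0 s"
proof -
  have "leg (edge B f) 0 s \<in> carrier (dobj G (edge B f))"
    using alg_homD(1)[OF leg_hom[OF edge_obj[OF f], of 0]] s by (simp add: edge_def)
  then show ?thesis
    unfolding descent_map_def
    using alg_iso_inv(4)[OF point_algebra[OF cod_closed[OF f]] edge_leg_iso[OF f]] by blast
qed

text \<open>The identity from which all properties of the descended diagram follow. For the edge
  \<open>[z\<^sub>i \<rightarrow> z\<^sub>j]\<close> it holds by definition, and the chord transports it to \<open>z\<close>.\<close>

lemma leg_descent:
  assumes z: "z \<in> Obj N" and ij: "i \<le> j" "j \<le> dim z" and s: "s \<in> carrier (dobj G (point (fst z ! i)))"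
  shows "leg z j (descent_map (segment B z i j) s) = leg z i s"
proof -
  let ?f = "segment B z i j"
  let ?c = "chord B z i j"
  have zs: "z \<in> strings B" using z by simp
  have f: "?f \<in> Arr B" "Dom B ?f = fst z ! i" "Cod B ?f = fst z ! j"
    using segment_props[OF zs ij] by auto
  have e: "edge B ?f \<in> Obj N" by (rule edge_obj[OF f(1)])
  have c: "?c \<in> Arr N" by (rule chord_arr[OF z ij k])
  have v: "vertex (edge B ?f) 0 \<in> Arr N" "vertex (edge B ?f) 1 \<in> Arr N"
    by (rule vertex_arr[OF e]; simp)+
  have ends: "fst (edge B ?f) ! 0 = fst z ! i" "fst (edge B ?f) ! 1 = fst z ! j"
    using f by (simp_all add: edge_def)
  have Fs: "descent_map ?f s \<in> carrier (dobj G (point (fst z ! j)))"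
    using alg_homD(1)[OF descent_map_hom[OF f(1)]] s f by simp
  have "leg z j (descent_map ?f s) = darr G ?c (leg (edge B ?f) 1 (descent_map ?f s))"
    using alg_diagramD(4)[OF G v(2) c] Fs ends Cmp_chord_vertex(2)[OF zs ij] by simp
  also have "\<dots> = darr G ?c (leg (edge B ?f) 0 s)"
    using leg_descent_edge[OF f(1)] s f by simp
  also have "\<dots> = leg z i s"
    using alg_diagramD(4)[OF G v(1) c] s ends Cmp_chord_vertex(1)[OF zs ij] by simp
  finally show ?thesis .
qed

lemma last_leg_inj:
  assumes "z \<in> Obj N" and "s \<in> carrier (dobj G (point (eps_obj z)))" and "t \<in> carrier (dobj G (point (eps_obj z)))"
    and "leg z (dim z) s = leg z (dim z) t"
  shows "s = t"
  using last_leg_iso(1)[OF assms(1)] assms(2-4) by (auto simp: alg_iso_def bij_betw_def dest: inj_onD)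

lemma descent_map_Ide:
  assumes x: "x \<in> Obj B" and s: "s \<in> carrier (dobj G (point x))"
  shows "descent_map (Ide B x) s = s"
proof -
  have p: "point x \<in> Obj N" by (rule point_obj[OF x])
  have Fs: "descent_map (Ide B x) s \<in> carrier (dobj G (point x))"
    using alg_homD(1)[OF descent_map_hom[OF ide_closed[OF x]]] s x by (simp add: dom_ide cod_ide)
  have "leg (point x) 0 (descent_map (Ide B x) s) = leg (point x) 0 s"
    using leg_descent[OF p, of 0 0 s] s by simp
  then show ?thesis
    using last_leg_inj[OF p, of "descent_map (Ide B x) s" s] Fs s by simp
qed

text \<open>The three edges of the triangle \<open>x \<rightarrow> y \<rightarrow> z\<close> relate its three vertices, and the leg at the last
  vertex is injective. This is the only use of strings of length two.\<close>

lemma descent_map_Cmp: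
  assumes f: "f \<in> Arr B" and g: "g \<in> Arr B" and fg: "Dom B g = Cod B f"
    and s: "s \<in> carrier (dobj G (point (Dom B f)))"
  shows "descent_map (Cmp B g f) s = descent_map g (descent_map f s)"
proof -
  let ?t = "triangle B f g"
  have t: "?t \<in> Obj N" by (rule triangle_obj[OF f g fg])
  have pts: "fst ?t ! 0 = Dom B f" "fst ?t ! 1 = Cod B f" "fst ?t ! 2 = Cod B g" "eps_obj ?t = Cod B g"
    by (simp_all add: triangle_def eps_obj_def dim_def)
  have Fs: "descent_map f s \<in> carrier (dobj G (point (Cod B f)))"
    using alg_homD(1)[OF descent_map_hom[OF f] s] .
  have FFs: "descent_map g (descent_map f s) \<in> carrier (dobj G (point (Cod B g)))"
    using alg_homD(1)[OF descent_map_hom[OF g]] Fs fg by simp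
  have Cs: "descent_map (Cmp B g f) s \<in> carrier (dobj G (point (Cod B g)))"
    using alg_homD(1)[OF descent_map_hom[OF cmp_closed[OF f g fg]]] s
    by (simp add: dom_cmp[OF f g fg] cod_cmp[OF f g fg])
  have "leg ?t 2 (descent_map (Cmp B g f) s) = leg ?t 0 s"
    using leg_descent[OF t, of 0 2 s] s pts segment_triangle(3)[OF f g fg] by simp
  also have "\<dots> = leg ?t 1 (descent_map f s)"
    using leg_descent[OF t, of 0 1 s] s pts segment_triangle(1)[OF f g fg] by simp
  also have "\<dots> = leg ?t 2 (descent_map g (descent_map f s))"
    using leg_descent[OF t, of 1 2 "descent_map f s"] Fs pts segment_triangle(2)[OF f g fg] by simp
  finally show ?thesis
    using last_leg_inj[OF t, of "descent_map (Cmp B g f) s"] Cs FFs pts by simp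
qed

lemma descent_deformation: "(descent, \<lambda>x. \<psi> (point x)) \<in> deformations B K A S"
proof -
  have "alg_diagram B A descent"
    unfolding alg_diagram_def descent_def
    by (auto simp: point_algebra descent_map_hom descent_map_Ide descent_map_Cmp)
  moreover have "\<psi> (point (Cod B f)) (descent_map f s) = darr S f (\<psi> (point (Dom B f)) s)"
    if f: "f \<in> Arr B" and s: "s \<in> carrier (dobj G (point (Dom B f)))" for f s
  proof -
    let ?e = "edge B f"
    have e: "?e \<in> Obj N" by (rule edge_obj[OF f])
    have ends: "fst ?e ! 0 = Dom B f" "eps_obj ?e = Cod B f"
      by (simp_all add: edge_def eps_obj_def dim_def)
    have Fs: "descent_map f s \<in> carrier (dobj G (point (Cod B f)))"
      using alg_homD(1)[OF descent_map_hom[OF f] s] .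
    \<comment> \<open>The last leg of the edge lies over an identity, so \<open>\<psi>\<close> does not see it.\<close>
    have "\<psi> (point (Cod B f)) (descent_map f s) = \<psi> ?e (leg ?e 1 (descent_map f s))"
      using last_leg_iso(2)[OF e] Fs ends by simp
    also have "\<dots> = \<psi> ?e (leg ?e 0 s)"
      using leg_descent_edge[OF f s] by simp
    also have "\<dots> = darr S f (\<psi> (point (Dom B f)) s)"
      using natural[OF vertex_arr[OF e, of 0], of s] s ends segment_edge[OF f] by simp
    finally show ?thesis .
  qed
  moreover have "is_reduction (dobj G (point x)) (dobj S x) (\<psi> (point x))" if "x \<in> Obj B" for x
    using reduction[OF point_obj[OF that]] by simp
  ultimately show ?thesis
    by (simp add: deformations_iff[OF S] descent_def)
qed

text \<open>The isomorphism is given by the last vertices \<open>[x\<^sub>n] \<rightarrow> [x\<^sub>0 \<rightarrow> \<dots> \<rightarrow> x\<^sub>n]\<close>, which \<open>\<epsilon>\<close> maps to identities.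
  For \<open>h : x \<rightarrow> y\<close>, both sides of the naturality square are the leg of \<open>y\<close> at the position \<open>h(n)\<close>.\<close>

lemma eps_descent_iso: "(eps_defo B (descent, \<lambda>x. \<psi> (point x)), (G, \<psi>)) \<in> defo_iso N K A epsS"
  unfolding eps_defo_def prod.case
proof (rule defo_isoI[where \<eta> = "\<lambda>z. leg z (dim z)"])
  show "(eps_diagram B descent, \<lambda>x. \<psi> (point (eps_obj x))) \<in> deformations N K A epsS"
    using eps_defo_closed[OF descent_deformation] by (simp add: eps_defo_def)
  show "(G, \<psi>) \<in> deformations N K A epsS" by (rule deformation)
  show "leg z (dim z) \<in> alg_iso A (dobj (eps_diagram B descent) z) (dobj G z)" if "z \<in> Obj N" for z
    using last_leg_iso(1)[OF that] by (simp add: descent_def)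
  show "\<psi> z (leg z (dim z) s) = \<psi> (point (eps_obj z)) s"
    if "z \<in> Obj N" "s \<in> carrier (dobj (eps_diagram B descent) z)" for z s
    using last_leg_iso(2)[OF that(1)] that(2) by (simp add: descent_def)
  show "leg (Cod N a) (dim (Cod N a)) (darr (eps_diagram B descent) a s) =
      darr G a (leg (Dom N a) (dim (Dom N a)) s)"
    if a: "a \<in> Arr N" and s: "s \<in> carrier (dobj (eps_diagram B descent) (Dom N a))" for a s
  proof -
    obtain x h y where a': "a = (x, h, y)" by (cases a)
    have y: "y \<in> Obj N" and h: "h \<in> simplex_hom B x y" using a a' by auto
    have s': "s \<in> carrier (dobj G (point (fst x ! dim x)))"
      using s by (simp add: a' descent_def eps_obj_def)
    have "leg y (dim y) (descent_map (segment B y (h (dim x)) (dim y)) s) = leg y (h (dim x)) s"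
      by (rule leg_descent[OF y]) (use simplex_homD(1,3)[OF h, of "dim x"] s' in auto)
    also have "\<dots> = darr G a (leg x (dim x) s)"
      using leg_arr[OF a[unfolded a'] order_refl s'] by (simp add: a')
    finally show ?thesis
      by (simp add: a' descent_def eps_arr_def)
  qed
qed

end

theorem proposition7p3:
  fixes K :: "'k ring"
    and B :: "('o, 'm) cat"
    and S :: "('o, 'm, 'k, 's) diagram"
    and A :: "('k, 'a) module"
    and k :: enat
  assumes "field K"
    and char_0: "\<And>n :: nat. n > 0 \<Longrightarrow> [n] \<cdot>\<^bsub>K\<^esub> \<one>\<^bsub>K\<^esub> \<noteq> \<zero>\<^bsub>K\<^esub>"
    and "category B"
    and "alg_diagram B K S"
    and "k \<ge> 2"
    and "A \<in> Art K"
  shows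
    "equiv (deformations B K A S :: ('o, 'm, 'a, 'c, 's) defo set) (defo_iso B K A S) \<and>
     equiv (deformations (simplex_cat B k) K A (eps_diagram B S)
             :: (('o, 'm) strng, ('o, 'm) strng_arr, 'a, 'c, 's) defo set)
           (defo_iso (simplex_cat B k) K A (eps_diagram B S)) \<and>
     (\<forall>d \<in> (deformations B K A S :: ('o, 'm, 'a, 'c, 's) defo set).
        eps_defo B d \<in> deformations (simplex_cat B k) K A (eps_diagram B S)) \<and>
     (\<forall>d d' :: ('o, 'm, 'a, 'c, 's) defo. (d, d') \<in> defo_iso B K A S \<longrightarrow>
        (eps_defo B d, eps_defo B d') \<in> defo_iso (simplex_cat B k) K A (eps_diagram B S)) \<and>
     bij_betw (\<lambda>C. defo_iso (simplex_cat B k) K A (eps_diagram B S) `` (eps_defo B ` C))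
       (defo_classes B K A S :: ('o, 'm, 'a, 'c, 's) defo set set)
       (defo_classes (simplex_cat B k) K A (eps_diagram B S))"
proof -
  interpret deformation_setup K A B S k
    using assms
    by (simp add: deformation_setup_def deformation_setup_axioms_def artin_algebra_def artin_algebra_axioms_def)
  have eqB: "equiv (deformations B K A S :: ('o, 'm, 'a, 'c, 's) defo set) (defo_iso B K A S)"
    by (rule equiv_defo_iso) (simp add: dom_closed cod_closed)
  have eqN: "equiv (deformations N K A epsS
      :: (('o, 'm) strng, ('o, 'm) strng_arr, 'a, 'c, 's) defo set) (defo_iso N K A epsS)"
    by (rule equiv_defo_iso) (rule simplex_cat_dom_cod)
  have closed: "eps_defo B d \<in> deformations N K A epsS"
    if "d \<in> deformations B K A S" for d :: "('o, 'm, 'a, 'c, 's) defo"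
    using eps_defo_closed that by (cases d) blast
  have iso: "(eps_defo B d, eps_defo B d') \<in> defo_iso N K A epsS"
    if "(d, d') \<in> defo_iso B K A S" for d d' :: "('o, 'm, 'a, 'c, 's) defo"
    using eps_defo_iso that by (cases d, cases d') blast
  have reflects: "(d, d') \<in> defo_iso B K A S"
    if "d \<in> deformations B K A S" "d' \<in> deformations B K A S"
      "(eps_defo B d, eps_defo B d') \<in> defo_iso N K A epsS" for d d' :: "('o, 'm, 'a, 'c, 's) defo"
    using eps_defo_reflects_iso that by (cases d, cases d') blast
  have surj: "\<exists>d\<in>deformations B K A S. (eps_defo B d, e) \<in> defo_iso N K A epsS"
    if e: "e \<in> deformations N K A epsS" for e :: "(('o, 'm) strng, ('o, 'm) strng_arr, 'a, 'c, 's) defo"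
  proof -
    obtain G \<psi> where e': "e = (G, \<psi>)" by (cases e)
    interpret simplex_deformation K A B S k G \<psi>
      by unfold_locales (use e e' in simp)
    show ?thesis using descent_deformation eps_descent_iso e' by blast
  qed
  have "bij_betw (\<lambda>C. defo_iso N K A epsS `` (eps_defo B ` C))
      (deformations B K A S // defo_iso B K A S :: ('o, 'm, 'a, 'c, 's) defo set set)
      (deformations N K A epsS // defo_iso N K A epsS)"
    by (rule quotient_bij_betw[OF eqB eqN closed _ surj]) (use iso reflects in blast)+
  then show ?thesis
    using eqB eqN closed iso unfolding defo_classes_def by blast
qed

end
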